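(* The presentation $$\mathcal{P}'= \langle x,y\,\vert\, y^2=x^7,\quad y^{-1}xyx^{2}=x^3y^{-1}x^2y\rangle$$ is a presentation of the quaternion group $Q_{28}$ of order $28$, and it has a non-standard second homotopy group: if $X_{\mathcal{P}'}$ is the Cayley complex of $\mathcal{P}'$ and $X_{\mathcal{P}}$ is the Cayley complex of the standard presentation $$\mathcal{P}= \langle x,y\,\vert\, y^2=x^7,\quad xyx=y\rangle$$ of $Q_{28}$, then $\pi_2(X_{\mathcal{P}'})\not\cong \pi_2(X_{\mathcal{P}})$ as modules over $\mathbb{Z}[Q_{28}]$, and this holds with respect to all identifications of the groups presented by $\mathcal{P}$ and $\mathcal{P}'$.
   Context: For $n\ge 2$, $Q_{4n}$ denotes the quaternion group of order $4n$, with standard presentation $\langle x,y\mid y^2=x^n,\ y=xyx\rangle$. The Cayley complex $X_{\mathcal{Q}}$ of a presentation $\mathcal{Q}$ is the 2-dimensional cell complex with one vertex, one edge for each generator and one disk for each relator, attached along the corresponding word (a relation $a=b$ is interpreted as the relator $a^{-1}b$). If $\mathcal{Q}$ presents $G$, then $\pi_1(X_{\mathcal{Q}})=G$, and $\pi_2(X_{\mathcal{Q}})$ is regarded as a right $\mathbb{Z}[G]$-module via the natural action of $\pi_1(X_{\mathcal{Q}})$. Equivalently, by the Hurewicz isomorphism it is the right $\mathbb{Z}[G]$-module $H_2(\widetilde{X_{\mathcal{Q}}})=\ker(\partial_2\colon C_2(\widetilde{X_{\mathcal{Q}}})\to C_1(\widetilde{X_{\mathcal{Q}}}))$, where $\widetilde{X_{\mathcal{Q}}}$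 is the universal cover. *)

theory Defs
  imports "HOL-Algebra.Algebra" "HOL-Library.Poly_Mapping"
begin

section \<open>Group presentations\<close>

text \<open>A word is a list of letters; \<open>(x, True)\<close> stands for the generator \<open>x\<close> and \<open>(x, False)\<close>
  for its inverse. A presentation is the list of its relators, and its generators are all the
  elements of the type \<open>'x\<close>. Relators form a list, not a set, so that a repeated relator
  contributes several 2-cells to the Cayley complex.\<close>

type_synonym 'x word = "('x \<times> bool) list"
type_synonym 'x presentation = "'x word list"

definition word_inv :: "'x word \<Rightarrow> 'x word" where
  "word_inv w = rev (map (\<lambda>(x, b). (x, \<not> b)) w)"

definition word_pow :: "'x word \<Rightarrow> nat \<Rightarrow> 'x word" where
  "word_pow w n = concat (replicate n w)"

definition relation :: "'x word \<Rightarrow> 'x word \<Rightarrow> 'x word" where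
  "relation a b = word_inv a @ b"

inductive word_eq :: "'x presentation \<Rightarrow> 'x word \<Rightarrow> 'x word \<Rightarrow> bool" for R where
  refl: "word_eq R u u"
| sym: "word_eq R u v \<Longrightarrow> word_eq R v u"
| trans: "word_eq R u v \<Longrightarrow> word_eq R v w \<Longrightarrow> word_eq R u w"
| cancel: "word_eq R (u @ [(x, b), (x, \<not> b)] @ v) (u @ v)"
| relator: "r \<in> set R \<Longrightarrow> word_eq R (u @ r @ v) (u @ v)"

definition word_rel :: "'x presentation \<Rightarrow> 'x word rel" where
  "word_rel R = {(u, v). word_eq R u v}"

abbreviation word_class :: "'x presentation \<Rightarrow> 'x word \<Rightarrow> 'x word set" where
  "word_class R w \<equiv> word_rel R `` {w}"

definition presented_group :: "'x presentation \<Rightarrow> 'x word set monoid" where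
  "presented_group R =
    \<lparr>carrier = UNIV // word_rel R,
     monoid.mult = (\<lambda>A B. \<Union>u\<in>A. \<Union>v\<in>B. word_class R (u @ v)),
     one = word_class R []\<rparr>"

lemma equiv_word_rel: "equiv UNIV (word_rel R)"
  unfolding word_rel_def
  by (rule equivI) (auto simp: refl_on_def sym_def trans_def intro: word_eq.intros)

lemma word_class_eq_iff: "word_class R u = word_class R v \<longleftrightarrow> word_eq R u v"
  using eq_equiv_class_iff[OF equiv_word_rel, of u v] by (simp add: word_rel_def)

lemma word_eq_append1: "word_eq R u u' \<Longrightarrow> word_eq R (u @ v) (u' @ v)"
proof (induction rule: word_eq.induct)
  case (cancel u x b w)
  then show ?case using word_eq.cancel[of R u x b "w @ v"] by simp
next
  case (relator r u w)
  then show ?case using word_eq.relator[of r R u "w @ v"] by simp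
qed (auto intro: word_eq.intros)

lemma word_eq_append2: "word_eq R v v' \<Longrightarrow> word_eq R (u @ v) (u @ v')"
proof (induction rule: word_eq.induct)
  case (cancel w x b v)
  then show ?case using word_eq.cancel[of R "u @ w" x b v] by simp
next
  case (relator r w v)
  then show ?case using word_eq.relator[of r R "u @ w" v] by simp
qed (auto intro: word_eq.intros)

lemma word_eq_append: "word_eq R u u' \<Longrightarrow> word_eq R v v' \<Longrightarrow> word_eq R (u @ v) (u' @ v')"
  by (meson word_eq.trans word_eq_append1 word_eq_append2)

lemma word_eq_inv_left: "word_eq R (word_inv w @ w) []"
proof (induction w)
  case Nil
  then show ?case by (simp add: word_inv_def word_eq.refl)
next
  case (Cons a w)
  obtain x b where a: "a = (x, b)" by (cases a)
  have "word_inv (a # w) @ a # w = word_inv w @ [(x, \<not> b), (x, \<not> \<not> b)] @ w"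
    by (simp add: a word_inv_def)
  then have "word_eq R (word_inv (a # w) @ a # w) (word_inv w @ w)"
    using word_eq.cancel[of R "word_inv w" x "\<not> b" w] by metis
  with Cons show ?case by (blast intro: word_eq.trans)
qed

lemma carrier_presented_group: "carrier (presented_group R) = range (word_class R)"
  by (auto simp: presented_group_def quotient_def)

lemma mult_presented_group:
  "word_class R u \<otimes>\<^bsub>presented_group R\<^esub> word_class R v = word_class R (u @ v)"
proof -
  have "word_class R (u' @ v') = word_class R (u @ v)"
    if "u' \<in> word_class R u" "v' \<in> word_class R v" for u' v'
  proof -
    have "word_eq R u' u" "word_eq R v' v"
      using that by (auto simp: word_rel_def intro: word_eq.sym)
    then show ?thesis unfolding word_class_eq_iff by (rule word_eq_append)
  qed
  moreover have "u \<in> word_class R u" "v \<in> word_class R v"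
    by (auto simp: word_rel_def intro: word_eq.refl)
  ultimately have "(\<Union>u'\<in>word_class R u. \<Union>v'\<in>word_class R v. word_class R (u' @ v')) =
      word_class R (u @ v)"
    by blast
  then show ?thesis by (simp add: presented_group_def)
qed

lemma one_presented_group: "\<one>\<^bsub>presented_group R\<^esub> = word_class R []"
  by (simp add: presented_group_def)

lemma group_presented_group: "group (presented_group R)"
proof (rule groupI)
  fix A assume "A \<in> carrier (presented_group R)"
  then obtain w where "A = word_class R w" by (auto simp: carrier_presented_group)
  then show "\<exists>B\<in>carrier (presented_group R). B \<otimes>\<^bsub>presented_group R\<^esub> A = \<one>\<^bsub>presented_group R\<^esub>"
    by (intro bexI[of _ "word_class R (word_inv w)"])
      (auto simp: mult_presented_group one_presented_group carrier_presented_group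
        word_class_eq_iff word_eq_inv_left)
qed (auto simp: carrier_presented_group one_presented_group mult_presented_group)


section \<open>Combinatorial 2-complexes and their second homology\<close>

text \<open>A letter \<open>(e, True)\<close> traverses the edge \<open>e\<close> from its source to its target, and
  \<open>(e, False)\<close> traverses it backwards. The 2-cell \<open>f\<close> is a disk attached along \<open>attach K f\<close>.\<close>

record ('v, 'e, 'f) two_complex =
  verts :: "'v set"
  edges :: "'e set"
  faces :: "'f set"
  src :: "'e \<Rightarrow> 'v"
  tgt :: "'e \<Rightarrow> 'v"
  attach :: "'f \<Rightarrow> ('e \<times> bool) list"

fun is_path :: "('v, 'e, 'f, 'z) two_complex_scheme \<Rightarrow> 'v \<Rightarrow> ('e \<times> bool) list \<Rightarrow> 'v \<Rightarrow> bool" where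
  "is_path K u [] v \<longleftrightarrow> u \<in> verts K \<and> u = v"
| "is_path K u ((e, b) # p) v \<longleftrightarrow>
    e \<in> edges K \<and> u = (if b then src K e else tgt K e) \<and>
    u \<in> verts K \<and> is_path K (if b then tgt K e else src K e) p v"

inductive path_homotopic ::
  "('v, 'e, 'f, 'z) two_complex_scheme \<Rightarrow> ('e \<times> bool) list \<Rightarrow> ('e \<times> bool) list \<Rightarrow> bool" for K where
  refl: "path_homotopic K p p"
| sym: "path_homotopic K p q \<Longrightarrow> path_homotopic K q p"
| trans: "path_homotopic K p q \<Longrightarrow> path_homotopic K q r \<Longrightarrow> path_homotopic K p r"
| cancel: "is_path K u (p @ [(e, b), (e, \<not> b)] @ q) v \<Longrightarrow>
    path_homotopic K (p @ [(e, b), (e, \<not> b)] @ q) (p @ q)"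
| face: "f \<in> faces K \<Longrightarrow> is_path K u (p @ attach K f @ q) v \<Longrightarrow>
    path_homotopic K (p @ attach K f @ q) (p @ q)"

definition boundary2 ::
  "('v, 'e, 'f, 'z) two_complex_scheme \<Rightarrow> ('f \<Rightarrow>\<^sub>0 int) \<Rightarrow> ('e \<Rightarrow>\<^sub>0 int)" where
  "boundary2 K = frag_extend (\<lambda>f. sum_list
    (map (\<lambda>(e, b). if b then frag_of e else - frag_of e) (attach K f)))"

definition homology2 :: "('v, 'e, 'f, 'z) two_complex_scheme \<Rightarrow> ('f \<Rightarrow>\<^sub>0 int) set" where
  "homology2 K = {c. Poly_Mapping.keys c \<subseteq> faces K \<and> boundary2 K c = 0}"


section \<open>The Cayley complex and its universal cover\<close>

definition cayley_complex :: "'x presentation \<Rightarrow> (unit, 'x, nat) two_complex" where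
  "cayley_complex R =
    \<lparr>verts = {()}, edges = UNIV, faces = {..<length R},
     src = (\<lambda>_. ()), tgt = (\<lambda>_. ()), attach = (\<lambda>i. R ! i)\<rparr>"

lemma cayley_is_path: "is_path (cayley_complex R) u p v"
  by (induction "cayley_complex R" u p v rule: is_path.induct) (auto simp: cayley_complex_def)

text \<open>Since the Cayley complex has a single vertex, every word is a loop, and the presented group
  is its edge-path fundamental group.\<close>

lemma path_homotopic_cayley_complex: "path_homotopic (cayley_complex R) = word_eq R"
proof (intro ext iffI)
  fix u v
  show "word_eq R u v" if "path_homotopic (cayley_complex R) u v"
    using that
  proof (induction rule: path_homotopic.induct)
    case (cancel u p e b q v)
    show ?case by (rule word_eq.cancel)
  next
    case (face f u p q v)
    then show ?case using word_eq.relator[of "R ! f" R p q] by (simp add: cayley_complex_def)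
  qed (auto intro: word_eq.intros)
  show "path_homotopic (cayley_complex R) u v" if "word_eq R u v"
    using that
  proof (induction rule: word_eq.induct)
    case (cancel u x b v)
    show ?case by (rule path_homotopic.cancel[OF cayley_is_path])
  next
    case (relator r u v)
    then obtain i where i: "i < length R" "r = R ! i" by (auto simp: in_set_conv_nth)
    then show ?case
      using path_homotopic.face[of i "cayley_complex R" "()" u v "()"] cayley_is_path[of R]
      by (simp add: cayley_complex_def)
  qed (auto intro: path_homotopic.intros)
qed

text \<open>The universal cover has the group elements as vertices, and the edge \<open>(g, x)\<close> runs from \<open>g\<close>
  to \<open>g x\<close>. The function \<open>lift_path\<close> lifts an edge path to start at a given vertex.\<close>

fun lift_path :: "'x presentation \<Rightarrow> 'x word set \<Rightarrow> 'x word \<Rightarrow> (('x word set \<times> 'x) \<times> bool) list" where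
  "lift_path R g [] = []"
| "lift_path R g ((x, b) # w) =
    (let h = g \<otimes>\<^bsub>presented_group R\<^esub> word_class R [(x, b)]
     in ((if b then g else h, x), b) # lift_path R h w)"

definition universal_cover ::
  "'x presentation \<Rightarrow> ('x word set, 'x word set \<times> 'x, 'x word set \<times> nat) two_complex" where
  "universal_cover R =
    \<lparr>verts = carrier (presented_group R),
     edges = carrier (presented_group R) \<times> edges (cayley_complex R),
     faces = carrier (presented_group R) \<times> faces (cayley_complex R),
     src = (\<lambda>(g, x). g),
     tgt = (\<lambda>(g, x). g \<otimes>\<^bsub>presented_group R\<^esub> word_class R [(x, True)]),
     attach = (\<lambda>(g, i). lift_path R g (attach (cayley_complex R) i))\<rparr>"

lemma universal_cover_simps [simp]:
  "verts (universal_cover R) = carrier (presented_group R)"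
  "edges (universal_cover R) = carrier (presented_group R) \<times> UNIV"
  "faces (universal_cover R) = carrier (presented_group R) \<times> {..<length R}"
  "src (universal_cover R) (g, x) = g"
  "tgt (universal_cover R) (g, x) = g \<otimes>\<^bsub>presented_group R\<^esub> word_class R [(x, True)]"
  "attach (universal_cover R) (g, i) = lift_path R g (R ! i)"
  by (simp_all add: universal_cover_def cayley_complex_def)

text \<open>The next lemmas confirm that this is the universal cover: it is connected, the attaching
  paths of its 2-cells are closed, and every closed edge path is homotopic to the empty path.\<close>

lemma lift_path_append:
  assumes "g \<in> carrier (presented_group R)"
  shows "lift_path R g (u @ v) =
    lift_path R g u @ lift_path R (g \<otimes>\<^bsub>presented_group R\<^esub> word_class R u) v"
  using assms
proof (induction u arbitrary: g)
  case Nil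
  then show ?case
    by (auto simp: carrier_presented_group mult_presented_group)
next
  case (Cons a u)
  then show ?case
    by (cases a) (auto simp: carrier_presented_group mult_presented_group Let_def)
qed

lemma is_path_lift_path:
  assumes "g \<in> carrier (presented_group R)"
  shows "is_path (universal_cover R) g (lift_path R g w) (g \<otimes>\<^bsub>presented_group R\<^esub> word_class R w)"
  using assms
proof (induction w arbitrary: g)
  case Nil
  then show ?case
    by (auto simp: carrier_presented_group mult_presented_group)
next
  case (Cons a w)
  obtain x b where a: "a = (x, b)" by (cases a)
  let ?G = "presented_group R"
  let ?h = "g \<otimes>\<^bsub>?G\<^esub> word_class R [(x, b)]"
  obtain u where u: "g = word_class R u" using Cons.prems by (auto simp: carrier_presented_group)
  have h: "?h \<in> carrier ?G" by (auto simp: u carrier_presented_group mult_presented_group)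
  have end_eq: "?h \<otimes>\<^bsub>?G\<^esub> word_class R w = g \<otimes>\<^bsub>?G\<^esub> word_class R (a # w)"
    by (simp add: u mult_presented_group a)
  have ret: "?h \<otimes>\<^bsub>?G\<^esub> word_class R [(x, \<not> b)] = g"
    using word_eq.cancel[of R u x b "[]"] by (simp add: u mult_presented_group word_class_eq_iff)
  have "is_path (universal_cover R) ?h (lift_path R ?h w) (g \<otimes>\<^bsub>?G\<^esub> word_class R (a # w))"
    using Cons.IH[OF h] end_eq by simp
  then show ?case
    using Cons.prems h ret
    by (cases b) (simp_all add: a Let_def)
qed

lemma universal_cover_connected:
  assumes "g \<in> verts (universal_cover R)" "h \<in> verts (universal_cover R)"
  shows "\<exists>p. is_path (universal_cover R) g p h"
proof -
  obtain u v where "g = word_class R u" "h = word_class R v"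
    using assms by (auto simp: carrier_presented_group)
  moreover have "word_eq R (u @ word_inv u @ v) v"
  proof -
    have "word_eq R (u @ word_inv u) []"
      using word_eq_inv_left[of R "word_inv u"]
      by (simp add: word_inv_def rev_map case_prod_beta comp_def)
    from word_eq_append1[OF this, of v] show ?thesis by simp
  qed
  ultimately have "g \<otimes>\<^bsub>presented_group R\<^esub> word_class R (word_inv u @ v) = h"
    by (simp add: mult_presented_group word_class_eq_iff)
  then show ?thesis
    using is_path_lift_path[of g R "word_inv u @ v"] assms by auto
qed

lemma universal_cover_attach_closed:
  assumes "(g, i) \<in> faces (universal_cover R)"
  shows "is_path (universal_cover R) g (attach (universal_cover R) (g, i)) g"
proof -
  have "g \<in> carrier (presented_group R)" "i < length R"
    using assms by auto
  moreover from this obtain u where "g = word_class R u" by (auto simp: carrier_presented_group)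
  ultimately show ?thesis
    using is_path_lift_path[of g R "R ! i"]
      word_class_eq_iff[of R "u @ R ! i" u] word_eq.relator[of "R ! i" R u "[]"]
    by (simp add: mult_presented_group)
qed

lemma universal_cover_path_is_lift:
  assumes "is_path (universal_cover R) g p h"
  shows "g \<in> carrier (presented_group R) \<and>
    p = lift_path R g (map (\<lambda>((_, x), b). (x, b)) p) \<and>
    h = g \<otimes>\<^bsub>presented_group R\<^esub> word_class R (map (\<lambda>((_, x), b). (x, b)) p)"
  using assms
proof (induction p arbitrary: g)
  case Nil
  then show ?case
    by (auto simp: carrier_presented_group mult_presented_group)
next
  case (Cons y p)
  obtain k x b where y: "y = ((k, x), b)" by (metis surj_pair)
  let ?G = "presented_group R"
  let ?t = "if b then k \<otimes>\<^bsub>?G\<^esub> word_class R [(x, True)] else k"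
  have k: "k \<in> carrier ?G" and g: "g \<in> carrier ?G"
    and g_eq: "g = (if b then k else k \<otimes>\<^bsub>?G\<^esub> word_class R [(x, True)])"
    and p: "is_path (universal_cover R) ?t p h"
    using Cons.prems by (auto simp: y split: if_splits)
  obtain u where u: "k = word_class R u" using k by (auto simp: carrier_presented_group)
  obtain w where w: "g = word_class R w" using g by (auto simp: carrier_presented_group)
  have ret: "word_class R (u @ [(x, True), (x, False)]) = k"
    using word_eq.cancel[of R u x True "[]"] by (simp add: u word_class_eq_iff)
  have t: "?t = g \<otimes>\<^bsub>?G\<^esub> word_class R [(x, b)]"
    using ret by (simp add: g_eq u mult_presented_group)
  note IH = Cons.IH[OF p]
  have "(if b then g else ?t) = k"
    by (simp add: g_eq)
  then have "lift_path R g ((x, b) # q) = y # lift_path R ?t q" for q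
    unfolding t by (simp add: y Let_def)
  moreover have "g \<otimes>\<^bsub>?G\<^esub> word_class R ((x, b) # q) = ?t \<otimes>\<^bsub>?G\<^esub> word_class R q" for q
    unfolding t by (simp add: w mult_presented_group)
  ultimately show ?case
    using IH g by (simp add: y)
qed

lemma lift_path_homotopic:
  assumes "word_eq R u v" "g \<in> carrier (presented_group R)"
  shows "path_homotopic (universal_cover R) (lift_path R g u) (lift_path R g v)"
  using assms
proof (induction rule: word_eq.induct)
  case (cancel u x b v)
  let ?h = "g \<otimes>\<^bsub>presented_group R\<^esub> word_class R u"
  obtain w where w: "g = word_class R w" using cancel by (auto simp: carrier_presented_group)
  have ret: "word_class R (w @ u @ [(x, b), (x, \<not> b)]) = word_class R (w @ u)"
    using word_eq.cancel[of R "w @ u" x b "[]"] by (simp add: word_class_eq_iff)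
  have h: "?h \<in> carrier (presented_group R)"
    by (auto simp: w carrier_presented_group mult_presented_group)
  let ?e = "(if b then ?h else ?h \<otimes>\<^bsub>presented_group R\<^esub> word_class R [(x, b)], x)"
  have eq: "lift_path R g (u @ [(x, b), (x, \<not> b)] @ v) =
      lift_path R g u @ [(?e, b), (?e, \<not> b)] @ lift_path R ?h v"
    using cancel h ret by (cases b) (simp_all add: lift_path_append w mult_presented_group Let_def)
  show ?case
    using is_path_lift_path[OF cancel, of "u @ [(x, b), (x, \<not> b)] @ v"]
    unfolding eq lift_path_append[OF cancel, of u v] by (rule path_homotopic.cancel)
next
  case (relator r u v)
  then obtain i where i: "i < length R" "r = R ! i" by (auto simp: in_set_conv_nth)
  let ?h = "g \<otimes>\<^bsub>presented_group R\<^esub> word_class R u"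
  obtain w where w: "g = word_class R w" using relator by (auto simp: carrier_presented_group)
  have ret: "word_class R (w @ u @ r) = word_class R (w @ u)"
    using word_eq.relator[OF \<open>r \<in> set R\<close>, of "w @ u" "[]"] by (simp add: word_class_eq_iff)
  have h: "?h \<in> carrier (presented_group R)"
    by (auto simp: w carrier_presented_group mult_presented_group)
  have f: "(?h, i) \<in> faces (universal_cover R)"
    using h i by simp
  have eq: "lift_path R g (u @ r @ v) =
      lift_path R g u @ attach (universal_cover R) (?h, i) @ lift_path R ?h v"
    using relator h ret i
    by (simp add: lift_path_append w mult_presented_group)
  show ?case
    using path_homotopic.face[OF f] is_path_lift_path[OF relator(2), of "u @ r @ v"]
    unfolding eq lift_path_append[OF relator(2), of u v] by blast
qed (auto intro: path_homotopic.intros)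

lemma universal_cover_simply_connected:
  assumes "is_path (universal_cover R) g p g"
  shows "path_homotopic (universal_cover R) p []"
proof -
  define w where "w = map (\<lambda>((_, x), b). (x, b)) p"
  have g: "g \<in> carrier (presented_group R)" and p: "p = lift_path R g w"
    and "g = g \<otimes>\<^bsub>presented_group R\<^esub> word_class R w"
    using universal_cover_path_is_lift[OF assms] by (auto simp: w_def)
  then have "word_class R w = \<one>\<^bsub>presented_group R\<^esub>"
    using group.l_cancel_one'[OF group_presented_group] by (metis carrier_presented_group rangeI)
  then have "word_eq R w []" by (simp add: one_presented_group word_class_eq_iff)
  from lift_path_homotopic[OF this g] show ?thesis by (simp add: p)
qed


section \<open>Integral group rings and right modules\<close>

definition group_ring :: "('g, 'z) monoid_scheme \<Rightarrow> ('g \<Rightarrow>\<^sub>0 int) ring" where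
  "group_ring G =
    \<lparr>carrier = {a. Poly_Mapping.keys a \<subseteq> carrier G},
     monoid.mult = (\<lambda>a b. frag_extend (\<lambda>g. frag_extend (\<lambda>h. frag_of (g \<otimes>\<^bsub>G\<^esub> h)) b) a),
     one = frag_of \<one>\<^bsub>G\<^esub>,
     ring.zero = 0,
     ring.add = (+)\<rparr>"

definition group_ring_map :: "('g \<Rightarrow> 'h) \<Rightarrow> ('g \<Rightarrow>\<^sub>0 int) \<Rightarrow> ('h \<Rightarrow>\<^sub>0 int)" where
  "group_ring_map \<phi> = frag_extend (\<lambda>g. frag_of (\<phi> g))"

record ('r, 'm) right_module = "'m ring" +
  rsmult :: "'m \<Rightarrow> 'r \<Rightarrow> 'm"

locale right_module = R?: ring R + M?: abelian_group M
  for R :: "('r, 'z) ring_scheme" and M :: "('r, 'm, 'y) right_module_scheme" +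
  assumes rsmult_closed: "m \<in> carrier M \<Longrightarrow> a \<in> carrier R \<Longrightarrow> rsmult M m a \<in> carrier M"
    and rsmult_add_left: "m \<in> carrier M \<Longrightarrow> n \<in> carrier M \<Longrightarrow> a \<in> carrier R \<Longrightarrow>
      rsmult M (m \<oplus>\<^bsub>M\<^esub> n) a = rsmult M m a \<oplus>\<^bsub>M\<^esub> rsmult M n a"
    and rsmult_add_right: "m \<in> carrier M \<Longrightarrow> a \<in> carrier R \<Longrightarrow> b \<in> carrier R \<Longrightarrow>
      rsmult M m (a \<oplus>\<^bsub>R\<^esub> b) = rsmult M m a \<oplus>\<^bsub>M\<^esub> rsmult M m b"
    and rsmult_assoc: "m \<in> carrier M \<Longrightarrow> a \<in> carrier R \<Longrightarrow> b \<in> carrier R \<Longrightarrow>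
      rsmult M m (a \<otimes>\<^bsub>R\<^esub> b) = rsmult M (rsmult M m a) b"
    and rsmult_one: "m \<in> carrier M \<Longrightarrow> rsmult M m \<one>\<^bsub>R\<^esub> = m"

definition right_module_isomorphic ::
  "('r, 'z) ring_scheme \<Rightarrow> ('r, 'm, 'y) right_module_scheme \<Rightarrow> ('r, 'n, 'w) right_module_scheme \<Rightarrow> bool"
where
  "right_module_isomorphic R M N \<longleftrightarrow>
    (\<exists>f. bij_betw f (carrier M) (carrier N) \<and>
      (\<forall>m\<in>carrier M. \<forall>n\<in>carrier M. f (m \<oplus>\<^bsub>M\<^esub> n) = f m \<oplus>\<^bsub>N\<^esub> f n) \<and>
      (\<forall>m\<in>carrier M. \<forall>a\<in>carrier R. f (rsmult M m a) = rsmult N (f m) a))"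

definition restrict_scalars ::
  "('r \<Rightarrow> 's) \<Rightarrow> ('s, 'm) right_module \<Rightarrow> ('r, 'm) right_module" where
  "restrict_scalars \<sigma> M =
    \<lparr>carrier = carrier M, monoid.mult = monoid.mult M, one = one M, ring.zero = ring.zero M, ring.add = ring.add M,
     rsmult = (\<lambda>m a. rsmult M m (\<sigma> a))\<rparr>"


section \<open>The second homotopy module\<close>

text \<open>A deck transformation \<open>h\<close> sends the 2-cell \<open>(g, i)\<close> to \<open>(h g, i)\<close>. This is a left action, and
  the right action of the group is through inverses. The fields \<open>mult\<close> and \<open>one\<close> of the record
  have no meaning for a module.\<close>

definition chain2_act ::
  "('g, 'z) monoid_scheme \<Rightarrow> ('g \<times> 'i \<Rightarrow>\<^sub>0 int) \<Rightarrow> ('g \<Rightarrow>\<^sub>0 int) \<Rightarrow> ('g \<times> 'i \<Rightarrow>\<^sub>0 int)" where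
  "chain2_act G c a =
    frag_extend (\<lambda>h. frag_extend (\<lambda>(g, i). frag_of (inv\<^bsub>G\<^esub> h \<otimes>\<^bsub>G\<^esub> g, i)) c) a"

definition pi2 :: "'x presentation \<Rightarrow> ('x word set \<Rightarrow>\<^sub>0 int, 'x word set \<times> nat \<Rightarrow>\<^sub>0 int) right_module" where
  "pi2 R =
    \<lparr>carrier = homology2 (universal_cover R),
     monoid.mult = undefined, one = undefined,
     ring.zero = 0, ring.add = (+),
     rsmult = chain2_act (presented_group R)\<rparr>"

lemma frag_extend_add_fun: "frag_extend (\<lambda>x. f x + g x) c = frag_extend f c + frag_extend g c"
  by (simp add: frag_extend_def frag_cmul_distrib2 sum.distrib)

lemma frag_extend_diff_fun: "frag_extend (\<lambda>x. f x - g x) c = frag_extend f c - frag_extend g c"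
  using frag_extend_add_fun[of "\<lambda>x. f x - g x" g c] by (simp add: algebra_simps)

lemma frag_extend_zero_fun: "frag_extend (\<lambda>x. 0) c = 0"
  by (rule frag_extend_eq_0) simp

lemma ring_group_ring:
  assumes "group G"
  shows "ring (group_ring G)"
proof -
  interpret G: group G by fact
  have abel: "abelian_group (group_ring G)"
  proof (rule abelian_groupI)
    fix a assume a: "a \<in> carrier (group_ring G)"
    then show "\<exists>b\<in>carrier (group_ring G). b \<oplus>\<^bsub>group_ring G\<^esub> a = \<zero>\<^bsub>group_ring G\<^esub>"
      by (intro bexI[of _ "- a"]) (auto simp: group_ring_def)
  next
    fix a b assume "a \<in> carrier (group_ring G)" "b \<in> carrier (group_ring G)"
    then show "a \<oplus>\<^bsub>group_ring G\<^esub> b \<in> carrier (group_ring G)"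
      using keys_add[of a b] by (auto simp: group_ring_def)
  qed (auto simp: group_ring_def algebra_simps)
  have mon: "monoid (group_ring G)"
  proof (rule monoidI)
    fix a b assume "a \<in> carrier (group_ring G)" "b \<in> carrier (group_ring G)"
    then show "a \<otimes>\<^bsub>group_ring G\<^esub> b \<in> carrier (group_ring G)"
      by (fastforce simp: group_ring_def keys_frag_of dest!: subsetD[OF keys_frag_extend])
  next
    fix a b c
    assume abc: "a \<in> carrier (group_ring G)" "b \<in> carrier (group_ring G)" "c \<in> carrier (group_ring G)"
    have a: "Poly_Mapping.keys a \<subseteq> carrier G" and b: "Poly_Mapping.keys b \<subseteq> carrier G"
      and c: "Poly_Mapping.keys c \<subseteq> carrier G"
      using abc by (simp_all add: group_ring_def)
    let ?m = "\<lambda>a b. frag_extend (\<lambda>g. frag_extend (\<lambda>h. frag_of (g \<otimes>\<^bsub>G\<^esub> h)) b) a"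
    have 1: "?m (frag_of g) (?m (frag_of h) c) = ?m (frag_of (g \<otimes>\<^bsub>G\<^esub> h)) c"
      if "g \<in> carrier G" "h \<in> carrier G" for g h
      using c by (induction c rule: frag_induction)
        (use that in \<open>simp_all add: frag_extend_diff G.m_assoc\<close>)
    have 2: "?m (frag_of g) (?m b c) = ?m (?m (frag_of g) b) c" if "g \<in> carrier G" for g
      using b
    proof (induction b rule: frag_induction)
      case (one h)
      then show ?case using 1[OF that, of h] by simp
    qed (simp_all add: frag_extend_diff)
    have "?m a (?m b c) = ?m (?m a b) c"
      using a
    proof (induction a rule: frag_induction)
      case (one g)
      then show ?case using 2[of g] by simp
    qed (simp_all add: frag_extend_diff)
    then show "(a \<otimes>\<^bsub>group_ring G\<^esub> b) \<otimes>\<^bsub>group_ring G\<^esub> c = a \<otimes>\<^bsub>group_ring G\<^esub> (b \<otimes>\<^bsub>group_ring G\<^esub> c)"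
      by (simp add: group_ring_def)
  next
    fix a assume "a \<in> carrier (group_ring G)"
    then have a: "Poly_Mapping.keys a \<subseteq> carrier G" by (simp add: group_ring_def)
    then have "frag_extend (\<lambda>h. frag_of (\<one>\<^bsub>G\<^esub> \<otimes>\<^bsub>G\<^esub> h)) a = a"
      "frag_extend (\<lambda>h. frag_of (h \<otimes>\<^bsub>G\<^esub> \<one>\<^bsub>G\<^esub>)) a = a"
      by (induction a rule: frag_induction) (auto simp: frag_extend_diff)
    then show "\<one>\<^bsub>group_ring G\<^esub> \<otimes>\<^bsub>group_ring G\<^esub> a = a" "a \<otimes>\<^bsub>group_ring G\<^esub> \<one>\<^bsub>group_ring G\<^esub> = a"
      by (simp_all add: group_ring_def)
  qed (auto simp: group_ring_def keys_frag_of)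
  show ?thesis
    by (rule ringI[OF abel mon]) (simp_all add: group_ring_def frag_extend_add frag_extend_add_fun)
qed

lemma chain2_act_diff1: "chain2_act G (c - d) a = chain2_act G c a - chain2_act G d a"
  by (simp add: chain2_act_def frag_extend_diff frag_extend_diff_fun)

lemma chain2_act_diff2: "chain2_act G c (a - b) = chain2_act G c a - chain2_act G c b"
  by (simp add: chain2_act_def frag_extend_diff)

lemma chain2_act_add1: "chain2_act G (c + d) a = chain2_act G c a + chain2_act G d a"
  by (simp add: chain2_act_def frag_extend_add frag_extend_add_fun)

lemma chain2_act_add2: "chain2_act G c (a + b) = chain2_act G c a + chain2_act G c b"
  by (simp add: chain2_act_def frag_extend_add)

lemma chain2_act_0: "chain2_act G 0 a = 0" "chain2_act G c 0 = 0"
  by (simp_all add: chain2_act_def frag_extend_zero_fun)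

lemma chain2_act_of: "chain2_act G (frag_of (g, i)) (frag_of h) = frag_of (inv\<^bsub>G\<^esub> h \<otimes>\<^bsub>G\<^esub> g, i)"
  by (simp add: chain2_act_def)

lemma keys_chain2_act:
  assumes "group G" "Poly_Mapping.keys c \<subseteq> carrier G \<times> I" "Poly_Mapping.keys a \<subseteq> carrier G"
  shows "Poly_Mapping.keys (chain2_act G c a) \<subseteq> carrier G \<times> I"
proof -
  interpret group G by fact
  show ?thesis
    using assms(2,3) unfolding chain2_act_def
    by (fastforce simp: keys_frag_of dest!: subsetD[OF keys_frag_extend])
qed

lemma chain2_act_assoc:
  assumes "group G" "Poly_Mapping.keys c \<subseteq> carrier G \<times> I"
    "Poly_Mapping.keys a \<subseteq> carrier G" "Poly_Mapping.keys b \<subseteq> carrier G"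
  shows "chain2_act G c (a \<otimes>\<^bsub>group_ring G\<^esub> b) = chain2_act G (chain2_act G c a) b"
proof -
  interpret group G by fact
  let ?m = "monoid.mult (group_ring G)"
  have m: "?m (a - a') b = ?m a b - ?m a' b" "?m a (b - b') = ?m a b - ?m a b'"
    "?m 0 b = 0" "?m a 0 = 0" "?m (frag_of g) (frag_of h) = frag_of (g \<otimes>\<^bsub>G\<^esub> h)" for a a' b b' g h
    by (simp_all add: group_ring_def frag_extend_diff frag_extend_diff_fun frag_extend_zero_fun)
  have 1: "chain2_act G c (?m (frag_of g) (frag_of h)) =
      chain2_act G (chain2_act G c (frag_of g)) (frag_of h)"
    if "g \<in> carrier G" "h \<in> carrier G" for g h
    using assms(2)
  proof (induction c rule: frag_induction)
    case (one x)
    then show ?case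
      using that by (cases x) (auto simp: m chain2_act_of inv_mult_group m_assoc)
  qed (simp_all add: chain2_act_0 chain2_act_diff1)
  have 2: "chain2_act G c (?m (frag_of g) b) = chain2_act G (chain2_act G c (frag_of g)) b"
    if "g \<in> carrier G" for g
    using assms(4)
    by (induction b rule: frag_induction) (use 1 that in \<open>simp_all add: m chain2_act_0 chain2_act_diff2\<close>)
  show ?thesis
    using assms(3)
    by (induction a rule: frag_induction)
      (use 2 in \<open>simp_all add: m chain2_act_0 chain2_act_diff1 chain2_act_diff2\<close>)
qed

lemma chain2_act_one:
  assumes "group G" "Poly_Mapping.keys c \<subseteq> carrier G \<times> I"
  shows "chain2_act G c (frag_of \<one>\<^bsub>G\<^esub>) = c"
proof -
  interpret group G by fact
  show ?thesis
    using assms(2)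
    by (induction c rule: frag_induction)
      (auto simp: chain2_act_of chain2_act_0 chain2_act_diff1)
qed

lemma boundary2_chain2_act:
  assumes "Poly_Mapping.keys c \<subseteq> carrier (presented_group R) \<times> I"
    "Poly_Mapping.keys a \<subseteq> carrier (presented_group R)"
  shows "boundary2 (universal_cover R) (chain2_act (presented_group R) c a) =
    chain2_act (presented_group R) (boundary2 (universal_cover R) c) a"
proof -
  let ?G = "presented_group R"
  interpret group ?G by (rule group_presented_group)
  let ?s = "\<lambda>p. sum_list (map (\<lambda>(e, b). if b then frag_of e else - frag_of e) p)"
  have bd: "boundary2 (universal_cover R) (c - d) =
      boundary2 (universal_cover R) c - boundary2 (universal_cover R) d"
    "boundary2 (universal_cover R) 0 = 0" for c d
    by (simp_all add: boundary2_def frag_extend_diff)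
  have neg: "chain2_act ?G (- c) a = - chain2_act ?G c a" for c :: "'a word set \<times> 'a \<Rightarrow>\<^sub>0 int" and a
    using chain2_act_diff1[of ?G 0 c a] by (simp add: chain2_act_0)
  have lift: "?s (lift_path R (inv\<^bsub>?G\<^esub> h \<otimes>\<^bsub>?G\<^esub> g) w) = chain2_act ?G (?s (lift_path R g w)) (frag_of h)"
    if "g \<in> carrier ?G" "h \<in> carrier ?G" for g h w
    using that(1)
  proof (induction w arbitrary: g)
    case Nil
    then show ?case by (simp add: chain2_act_0)
  next
    case (Cons y w)
    obtain x b where y: "y = (x, b)" by (cases y)
    have x: "word_class R [(x, b)] \<in> carrier ?G" by (auto simp: carrier_presented_group)
    have assoc: "inv\<^bsub>?G\<^esub> h \<otimes>\<^bsub>?G\<^esub> g \<otimes>\<^bsub>?G\<^esub> word_class R [(x, b)] =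
        inv\<^bsub>?G\<^esub> h \<otimes>\<^bsub>?G\<^esub> (g \<otimes>\<^bsub>?G\<^esub> word_class R [(x, b)])"
      using Cons.prems that(2) x by (simp add: m_assoc)
    show ?case
      using Cons.IH[of "g \<otimes>\<^bsub>?G\<^esub> word_class R [(x, b)]"] Cons.prems x
      by (simp add: y Let_def assoc chain2_act_add1 chain2_act_diff1 chain2_act_of neg)
  qed
  have 1: "boundary2 (universal_cover R) (chain2_act ?G c (frag_of h)) =
      chain2_act ?G (boundary2 (universal_cover R) c) (frag_of h)" if "h \<in> carrier ?G" for h
    using assms(1)
  proof (induction c rule: frag_induction)
    case (one z)
    then obtain g i where "z = (g, i)" "g \<in> carrier ?G" by auto
    then show ?case
      using lift[OF _ that] by (simp add: chain2_act_of boundary2_def)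
  qed (simp_all add: chain2_act_0 chain2_act_diff1 bd)
  show ?thesis
    using assms(2)
    by (induction a rule: frag_induction) (use 1 in \<open>simp_all add: chain2_act_0 chain2_act_diff2 bd\<close>)
qed

lemma right_module_pi2: "right_module (group_ring (presented_group R)) (pi2 R)"
proof -
  let ?G = "presented_group R"
  interpret group ?G by (rule group_presented_group)
  have carr: "carrier (pi2 R) =
      {c. Poly_Mapping.keys c \<subseteq> carrier ?G \<times> {..<length R} \<and> boundary2 (universal_cover R) c = 0}"
    by (simp add: pi2_def homology2_def)
  have sel: "rsmult (pi2 R) = chain2_act ?G" "ring.add (pi2 R) = (+)" "ring.zero (pi2 R) = 0"
    by (simp_all add: pi2_def)
  have gr: "carrier (group_ring ?G) = {a. Poly_Mapping.keys a \<subseteq> carrier ?G}"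
    "ring.add (group_ring ?G) = (+)" "one (group_ring ?G) = frag_of \<one>\<^bsub>?G\<^esub>"
    by (simp_all add: group_ring_def)
  have abel: "abelian_group (pi2 R)"
  proof (rule abelian_groupI)
    fix a assume "a \<in> carrier (pi2 R)"
    then show "\<exists>b\<in>carrier (pi2 R). b \<oplus>\<^bsub>pi2 R\<^esub> a = \<zero>\<^bsub>pi2 R\<^esub>"
      by (intro bexI[of _ "- a"]) (auto simp: carr sel boundary2_def frag_extend_minus)
  next
    fix a b assume "a \<in> carrier (pi2 R)" "b \<in> carrier (pi2 R)"
    then show "a \<oplus>\<^bsub>pi2 R\<^esub> b \<in> carrier (pi2 R)"
      using keys_add[of a b] by (auto simp: carr sel boundary2_def frag_extend_add)
  next
    show "\<zero>\<^bsub>pi2 R\<^esub> \<in> carrier (pi2 R)" by (simp add: carr sel boundary2_def)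
  qed (auto simp: sel algebra_simps)
  have ax: "right_module_axioms (group_ring ?G) (pi2 R)"
  proof
    fix m a assume "m \<in> carrier (pi2 R)" "a \<in> carrier (group_ring ?G)"
    then show "rsmult (pi2 R) m a \<in> carrier (pi2 R)"
      using keys_chain2_act[OF is_group, of m "{..<length R}" a]
        boundary2_chain2_act[of m R "{..<length R}" a]
      by (simp add: carr gr sel chain2_act_0)
  next
    fix m a b
    assume "m \<in> carrier (pi2 R)" "a \<in> carrier (group_ring ?G)" "b \<in> carrier (group_ring ?G)"
    then show "rsmult (pi2 R) m (a \<otimes>\<^bsub>group_ring ?G\<^esub> b) = rsmult (pi2 R) (rsmult (pi2 R) m a) b"
      using chain2_act_assoc[OF is_group] by (auto simp: carr gr sel)
  next
    fix m assume "m \<in> carrier (pi2 R)"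
    then show "rsmult (pi2 R) m \<one>\<^bsub>group_ring ?G\<^esub> = m"
      using chain2_act_one[OF is_group] by (auto simp: carr gr sel)
  qed (simp_all add: sel gr chain2_act_add1 chain2_act_add2)
  show ?thesis
    by (intro right_module.intro ring_group_ring is_group abel ax)
qed


section \<open>The presentations of the quaternion group\<close>

datatype gen = GenX | GenY

abbreviation gX :: "gen word" where "gX \<equiv> [(GenX, True)]"
abbreviation gY :: "gen word" where "gY \<equiv> [(GenY, True)]"
abbreviation gY_inv :: "gen word" where "gY_inv \<equiv> [(GenY, False)]"

definition quaternion_group :: "nat \<Rightarrow> gen word set monoid" where
  "quaternion_group n = presented_group
    [relation (word_pow gY 2) (word_pow gX n),
     relation gY (gX @ gY @ gX)]"

definition standard_presentation :: "gen presentation" where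
  "standard_presentation =
    [relation (word_pow gY 2) (word_pow gX 7),
     relation (gX @ gY @ gX) gY]"

definition exotic_presentation :: "gen presentation" where
  "exotic_presentation =
    [relation (word_pow gY 2) (word_pow gX 7),
     relation (gY_inv @ gX @ gY @ word_pow gX 2) (word_pow gX 3 @ gY_inv @ word_pow gX 2 @ gY)]"

end

theory Submission
  imports Defs "HOL-Library.Numeral_Type" Complex_Main
begin

text \<open>The second homotopy module of the standard presentation is cyclic, because the kernel of its Fox
  matrix is generated by \<open>(z (x - 1), x z - y)\<close> with \<open>z = x\<^sup>7\<close>. Cyclicity does not depend on the
  identification of the groups, so it suffices that the exotic module is not cyclic.

  The second exotic relator is a product of conjugates of the second standard one, and its Fox
  derivatives are those of the latter multiplied by \<open>m = x\<^sup>-\<^sup>1 (1 - x\<^sup>2 - x\<^sup>3)\<close>. Hence exotic cycles are the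
  pairs \<open>(a z (x - 1), d)\<close> with \<open>d m = a (x z - y)\<close>. Map \<open>a\<close> to the quaternion order \<open>\<int>[\<zeta>, j]\<close>, where \<open>\<zeta>\<close>
  is a primitive 14th root of unity: the condition says that its image is \<open>A (1 + x y)\<close> with \<open>A\<close> in the
  order. Map \<open>a\<close> also to \<open>\<int>[i]\<close> by \<open>x \<mapsto> -1\<close>, \<open>y \<mapsto> i\<close>. Both images reduce to the same element of the
  field with 49 elements. For a generator, \<open>A\<close> and the image of \<open>a\<close> in \<open>\<int>[i]\<close> are units. The units of the
  totally definite order \<open>\<int>[\<zeta>, j]\<close> lie in \<open>\<int>[\<zeta>] \<union> \<int>[\<zeta>] j\<close>, so \<open>A\<close> reduces to \<open>u\<close> or \<open>u i\<close> with \<open>u\<close> in the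
  prime field, whereas \<open>1 + x y\<close> reduces to \<open>1 - i\<close>: a contradiction.\<close>

section \<open>A totally definite quaternion order\<close>

text \<open>\<open>Cubic a b c\<close> is \<open>a + b \<theta> + c \<theta>\<^sup>2\<close>, where \<open>\<theta>\<^sup>3 = \<theta>\<^sup>2 + 2 \<theta> - 1\<close>: the ring of integers of the
  maximal real subfield of the 7th cyclotomic field, with \<open>\<theta> = 2 cos (\<pi> / 7)\<close>.\<close>

datatype cubic = Cubic int int int

instantiation cubic :: comm_ring_1
begin
definition "0 = Cubic 0 0 0"
definition "1 = Cubic 1 0 0"
fun plus_cubic where "Cubic a b c + Cubic d e f = Cubic (a + d) (b + e) (c + f)"
fun minus_cubic where "Cubic a b c - Cubic d e f = Cubic (a - d) (b - e) (c - f)"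
fun uminus_cubic where "- Cubic a b c = Cubic (- a) (- b) (- c)"
fun times_cubic where
  "Cubic a b c * Cubic d e f =
    Cubic (a * d - (b * f + c * e) - c * f)
      (a * e + b * d + 2 * (b * f + c * e) + c * f)
      (a * f + b * e + c * d + (b * f + c * e) + 3 * (c * f))"
instance
proof
  fix a b c :: cubic
  show "a * b * c = a * (b * c)" "a * b = b * a" "(a + b) * c = a * c + b * c"
    "1 * a = a" "a + b + c = a + (b + c)" "a + b = b + a" "0 + a = a"
    "- a + a = 0" "a - b = a + - b" "(0 :: cubic) \<noteq> 1"
    by (cases a; cases b; cases c; simp add: zero_cubic_def one_cubic_def algebra_simps)+
qed
end

definition cubic_theta :: cubic where "cubic_theta = Cubic 0 1 0"

section \<open>Real embeddings and the norm of the cubic field\<close>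

fun cubic_at :: "real \<Rightarrow> cubic \<Rightarrow> real" where
  "cubic_at r (Cubic a b c) = of_int a + of_int b * r + of_int c * r\<^sup>2"

text \<open>The product of the three real conjugates, expanded by Vieta's formulas into an integral
  form; \<open>cubic_norm_prod\<close> proves the identity.\<close>

fun cubic_norm :: "cubic \<Rightarrow> int" where
  "cubic_norm (Cubic a b c) = a^3 - b^3 + c^3 + a\<^sup>2 * b + 5 * a\<^sup>2 * c - 2 * a * b\<^sup>2 + a * b * c
     + 6 * a * c\<^sup>2 - b\<^sup>2 * c + 2 * b * c\<^sup>2"

declare cubic_norm.simps [simp del]

definition cubic_root :: "real \<Rightarrow> bool" where
  "cubic_root r \<longleftrightarrow> r^3 = r\<^sup>2 + 2 * r - 1"

lemma cubic_at_add: "cubic_at r (a + b) = cubic_at r a + cubic_at r b"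
  by (cases a; cases b) (simp add: algebra_simps)

lemma cubic_at_mult:
  assumes "cubic_root r"
  shows "cubic_at r (a * b) = cubic_at r a * cubic_at r b"
proof (cases a; cases b)
  fix a1 a2 a3 b1 b2 b3 assume a: "a = Cubic a1 a2 a3" and b: "b = Cubic b1 b2 b3"
  have 3: "r^3 = r\<^sup>2 + 2 * r - 1" using assms by (simp add: cubic_root_def)
  have "r^4 = r * r^3" by (simp add: eval_nat_numeral)
  also have "\<dots> = r * (r\<^sup>2 + 2 * r - 1)" by (simp only: 3)
  also have "\<dots> = r^3 + 2 * r\<^sup>2 - r" by (simp add: algebra_simps power2_eq_square power3_eq_cube)
  finally have 4: "r^4 = 3 * r\<^sup>2 + r - 1" using 3 by simp
  have "cubic_at r a * cubic_at r b = of_int (a1 * b1) + of_int (a1 * b2 + a2 * b1) * r +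
      of_int (a1 * b3 + a2 * b2 + a3 * b1) * r\<^sup>2 + of_int (a2 * b3 + a3 * b2) * r^3 + of_int (a3 * b3) * r^4"
    by (simp add: a b algebra_simps eval_nat_numeral)
  also have "\<dots> = cubic_at r (a * b)"
    unfolding 3 4 a b by (simp add: algebra_simps)
  finally show ?thesis by simp
qed

lemma cubic_at_simps: "cubic_at r 0 = 0" "cubic_at r 1 = 1" "cubic_at r cubic_theta = r"
  by (simp_all add: zero_cubic_def one_cubic_def cubic_theta_def)

text \<open>Sign changes on [-2,-1], [0,1] and [1,2] give three real roots, and divided differences
  give Vieta's formulas. The bound 2 later makes s^2 + r s t + t^2 positive definite at each root
  r.\<close>

lemma cubic_roots_exist:
  obtains r s t where "cubic_root r" "cubic_root s" "cubic_root t" "\<bar>r\<bar> < 2" "\<bar>s\<bar> < 2" "\<bar>t\<bar> < 2"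
    "r + s + t = 1" "r * s + r * t + s * t = -2" "r * s * t = -1"
proof -
  define f :: "real \<Rightarrow> real" where "f = (\<lambda>r. r^3 - r\<^sup>2 - 2 * r + 1)"
  have c: "isCont f x" for x unfolding f_def by (intro continuous_intros)
  have v: "f (-2) = -7" "f (-1) = 1" "f 0 = 1" "f 1 = -1" "f 2 = 1"
    by (simp_all add: f_def)
  have "\<exists>r\<ge>-2. r \<le> -1 \<and> f r = 0" by (rule IVT) (simp_all add: v c)
  then obtain r where r: "-2 \<le> r" "r \<le> -1" and fr: "f r = 0" by blast
  have "\<exists>r\<ge>0. r \<le> 1 \<and> f r = 0" by (rule IVT2) (simp_all add: v c)
  then obtain s where s: "0 \<le> s" "s \<le> 1" and fs: "f s = 0" by blast
  have "\<exists>r\<ge>1. r \<le> 2 \<and> f r = 0" by (rule IVT) (simp_all add: v c)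
  then obtain t where t: "1 \<le> t" "t \<le> 2" and ft: "f t = 0" by blast
  have rn: "r \<noteq> -2" using fr v by auto
  have tn: "t \<noteq> 2" "t \<noteq> 1" using ft v by auto
  have eqs: "r^3 = r\<^sup>2 + 2 * r - 1" "s^3 = s\<^sup>2 + 2 * s - 1" "t^3 = t\<^sup>2 + 2 * t - 1"
    using fr fs ft by (simp_all add: f_def)
  have ne: "r \<noteq> s" "r \<noteq> t" "s \<noteq> t" using r s t tn by linarith+
  have diff: "(p - q) * (p\<^sup>2 + p * q + q\<^sup>2 - (p + q) - 2) =
      (p^3 - p\<^sup>2 - 2 * p) - (q^3 - q\<^sup>2 - 2 * q)" for p q :: real
    by (simp add: algebra_simps power2_eq_square power3_eq_cube)
  have "(r - s) * (r\<^sup>2 + r * s + s\<^sup>2 - (r + s) - 2) = 0" unfolding diff using eqs by simp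
  then have 1: "r\<^sup>2 + r * s + s\<^sup>2 - (r + s) - 2 = 0" using ne by simp
  have "(r - t) * (r\<^sup>2 + r * t + t\<^sup>2 - (r + t) - 2) = 0" unfolding diff using eqs by simp
  then have 2: "r\<^sup>2 + r * t + t\<^sup>2 - (r + t) - 2 = 0" using ne by simp
  \<comment> \<open>A second divided difference: subtracting the two quadratic relations leaves a
    factor that is linear in the roots.\<close>
  have "(s - t) * (r + s + t - 1) =
      (r\<^sup>2 + r * s + s\<^sup>2 - (r + s) - 2) - (r\<^sup>2 + r * t + t\<^sup>2 - (r + t) - 2)"
    by (simp add: algebra_simps power2_eq_square)
  then have 3: "r + s + t = 1" using ne 1 2 by simp
  then have t': "t = 1 - r - s" by simp
  have 4: "r * s + r * t + s * t = -2"
    unfolding t' using 1 by (simp add: algebra_simps power2_eq_square)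
  have "r * (r\<^sup>2 + r * s + s\<^sup>2 - (r + s) - 2) = 0" unfolding 1 by simp
  then have 5: "r * s * t = -1"
    unfolding t' using eqs(1) by (simp add: algebra_simps power2_eq_square power3_eq_cube)
  show thesis
    by (rule that[of r s t]) (use r s t rn tn 3 4 5 eqs in \<open>simp_all add: cubic_root_def\<close>)
qed

lemma cubic_norm_prod:
  fixes r s t :: real
  assumes "r + s + t = 1" "r * s + r * t + s * t = -2" "r * s * t = -1"
  shows "cubic_at r x * cubic_at s x * cubic_at t x = of_int (cubic_norm x)"
proof (cases x)
  case (Cubic a b c)
  let ?e = "r * s + r * t + s * t"
  \<comment> \<open>These rewrite the symmetric functions of the expansion in elementary ones, whose
    values are the assumptions.\<close>
  have sq: "r\<^sup>2 + s\<^sup>2 + t\<^sup>2 = (r + s + t)\<^sup>2 - 2 * ?e"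
    "r\<^sup>2 * s\<^sup>2 + r\<^sup>2 * t\<^sup>2 + s\<^sup>2 * t\<^sup>2 = ?e\<^sup>2 - 2 * (r + s + t) * (r * s * t)"
    "r\<^sup>2 * s + r\<^sup>2 * t + s\<^sup>2 * r + s\<^sup>2 * t + t\<^sup>2 * r + t\<^sup>2 * s = (r + s + t) * ?e - 3 * (r * s * t)"
    by (simp_all add: algebra_simps power2_eq_square)
  have "(A + B * r + C * r\<^sup>2) * (A + B * s + C * s\<^sup>2) * (A + B * t + C * t\<^sup>2) =
      A^3 + A\<^sup>2 * B * (r + s + t) + A\<^sup>2 * C * (r\<^sup>2 + s\<^sup>2 + t\<^sup>2) + A * B\<^sup>2 * ?e +
      A * B * C * (r\<^sup>2 * s + r\<^sup>2 * t + s\<^sup>2 * r + s\<^sup>2 * t + t\<^sup>2 * r + t\<^sup>2 * s) +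
      A * C\<^sup>2 * (r\<^sup>2 * s\<^sup>2 + r\<^sup>2 * t\<^sup>2 + s\<^sup>2 * t\<^sup>2) + B^3 * (r * s * t) +
      B\<^sup>2 * C * ((r * s * t) * (r + s + t)) + B * C\<^sup>2 * ((r * s * t) * ?e) + C^3 * (r * s * t)\<^sup>2"
    for A B C :: real
    by (simp add: algebra_simps power2_eq_square power3_eq_cube)
  note this[of "of_int a" "of_int b" "of_int c", unfolded sq assms]
  then show ?thesis
    unfolding Cubic cubic_at.simps cubic_norm.simps by (simp only:) (simp add: algebra_simps)
qed

lemma cubic_norm_eq_0:
  assumes "cubic_norm x = 0" shows "x = 0"
proof -
  \<comment> \<open>Infinite descent: 2 is inert in the cubic field.\<close>
  have ev: "even a \<and> even b \<and> even c" if "cubic_norm (Cubic a b c) = 0" for a b c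
  proof -
    have "even (cubic_norm (Cubic a b c))" unfolding that by simp
    then show ?thesis by (cases "even a"; cases "even b"; cases "even c") (simp_all add: cubic_norm.simps)
  qed
  have "cubic_norm (Cubic a b c) = 0 \<Longrightarrow> a = 0 \<and> b = 0 \<and> c = 0" for a b c
  proof (induction "nat (\<bar>a\<bar> + \<bar>b\<bar> + \<bar>c\<bar>)" arbitrary: a b c rule: less_induct)
    case less
    obtain a' b' c' where abc: "a = 2 * a'" "b = 2 * b'" "c = 2 * c'"
      using ev[OF less.prems] by (auto elim!: evenE)
    have "cubic_norm (Cubic a b c) = 8 * cubic_norm (Cubic a' b' c')"
      by (simp add: cubic_norm.simps abc power_mult_distrib algebra_simps)
    then have 0: "cubic_norm (Cubic a' b' c') = 0" using less.prems by linarith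
    show ?case
    proof (cases "a = 0 \<and> b = 0 \<and> c = 0")
      case False
      then have "nat (\<bar>a'\<bar> + \<bar>b'\<bar> + \<bar>c'\<bar>) < nat (\<bar>a\<bar> + \<bar>b\<bar> + \<bar>c\<bar>)" unfolding abc by auto
      from less.hyps[OF this 0] show ?thesis by (simp add: abc)
    qed
  qed
  then show ?thesis using assms by (metis cubic.exhaust zero_cubic_def)
qed

text \<open>\<open>Quat s t u v\<close> is \<open>(s + t x) + (u + v x) y\<close>, where \<open>x\<close> is a primitive 14th root of unity with
  \<open>x + x\<^sup>-\<^sup>1 = \<theta>\<close>, \<open>y\<^sup>2 = -1\<close> and \<open>y x = x\<^sup>-\<^sup>1 y\<close>. This is a maximal order in a totally definite
  quaternion algebra, of reduced norm \<open>quat_norm\<close>.\<close>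

datatype quat = Quat cubic cubic cubic cubic

instantiation quat :: ring_1
begin
definition "0 = Quat 0 0 0 0"
definition "1 = Quat 1 0 0 0"
fun plus_quat where "Quat a b c d + Quat a' b' c' d' = Quat (a + a') (b + b') (c + c') (d + d')"
fun minus_quat where "Quat a b c d - Quat a' b' c' d' = Quat (a - a') (b - b') (c - c') (d - d')"
fun uminus_quat where "- Quat a b c d = Quat (- a) (- b) (- c) (- d)"
text \<open>Uses x^2 = theta x - 1 and y (a + b x) = ((a + theta b) - b x) y, the latter because
  x^-1 = theta - x.\<close>

fun times_quat where
  "Quat s t u v * Quat a b c d =
    Quat (s * a - t * b - (u * (c + cubic_theta * d) + v * d))
      (s * b + t * a + cubic_theta * (t * b) - (v * (c + cubic_theta * d) - u * d - cubic_theta * (v * d)))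
      (s * c - t * d + (u * (a + cubic_theta * b) + v * b))
      (s * d + t * c + cubic_theta * (t * d) + (v * (a + cubic_theta * b) - u * b - cubic_theta * (v * b)))"
instance
proof
  fix a b c :: quat
  show "a * b * c = a * (b * c)"
    by (cases a; cases b; cases c; simp; intro conjI; simp only: algebra_simps; simp)
  show "(a + b) * c = a * c + b * c" "a * (b + c) = a * b + a * c"
    by (cases a; cases b; cases c; simp add: algebra_simps)+
  show  "1 * a = a" "a * 1 = a"
    by (cases a; simp add: one_quat_def)+
  show "a + b + c = a + (b + c)" "a + b = b + a" "0 + a = a"
    "- a + a = 0" "a - b = a + - b" "(0 :: quat) \<noteq> 1"
    by (cases a; cases b; cases c; simp add: zero_quat_def one_quat_def)+
qed
end

fun quat_norm :: "quat \<Rightarrow> cubic" where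
  "quat_norm (Quat s t u v) = s * s + cubic_theta * (s * t) + t * t + (u * u + cubic_theta * (u * v) + v * v)"

lemma quat_norm_mult: "quat_norm (a * b) = quat_norm a * quat_norm b"
  by (cases a; cases b; simp add: algebra_simps)

lemma quat_norm_1: "quat_norm 1 = 1"
  by (simp add: one_quat_def)

text \<open>Inverses and Bezout identities are certified in \<open>exo_not_cyclic\<close> only up to
  the factor 2, which is cancelled here.\<close>

lemma quat_double_cancel:
  fixes a b :: quat
  assumes "a + a = b + b" shows "a = b"
proof -
  have "x = y" if "x + x = y + y" for x y :: cubic
    using that by (cases x; cases y) auto
  then show ?thesis using assms by (cases a; cases b) auto
qed

section \<open>The Gaussian integers and, over the type \<open>7\<close>, the field with 49
  elements\<close>

datatype 'a gauss = Gauss 'a 'a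

instantiation gauss :: (comm_ring_1) ring_1
begin
definition "0 = Gauss 0 0"
definition "1 = Gauss 1 0"
fun plus_gauss where "Gauss a b + Gauss c d = Gauss (a + c) (b + d)"
fun minus_gauss where "Gauss a b - Gauss c d = Gauss (a - c) (b - d)"
fun uminus_gauss where "- Gauss a b = Gauss (- a) (- b)"
fun times_gauss where "Gauss a b * Gauss c d = Gauss (a * c - b * d) (a * d + b * c)"
instance
proof
  fix a b c :: "'a gauss"
  show "a * b * c = a * (b * c)" "(a + b) * c = a * c + b * c" "a * (b + c) = a * b + a * c"
    "1 * a = a" "a * 1 = a" "a + b + c = a + (b + c)" "a + b = b + a" "0 + a = a"
    "- a + a = 0" "a - b = a + - b" "(0 :: 'a gauss) \<noteq> 1"
    by (cases a; cases b; cases c; simp add: zero_gauss_def one_gauss_def algebra_simps)+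
qed
end

lemma gauss_unit:
  fixes a b :: "int gauss"
  assumes "b * a = 1"
  shows "a \<in> {Gauss 1 0, Gauss (-1) 0, Gauss 0 1, Gauss 0 (-1)}"
proof -
  obtain p q r s where ab: "a = Gauss p q" "b = Gauss r s" by (metis gauss.exhaust)
  have e: "p * r - q * s = 1" "p * s + q * r = 0"
    using assms by (simp_all add: ab one_gauss_def algebra_simps)
  \<comment> \<open>The norm is multiplicative, so at a unit it is a nonnegative integer dividing
    1.\<close>
  have "(p * p + q * q) * (r * r + s * s) = (p * r - q * s)^2 + (p * s + q * r)^2"
    by (simp add: algebra_simps power2_eq_square)
  then have "(p * p + q * q) * (r * r + s * s) = 1" by (simp add: e)
  then have n: "p * p + q * q = 1"
    by (metis zmult_eq_1_iff add_nonneg_nonneg zero_le_square neg_0_le_iff_le not_one_le_zero)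
  have "\<bar>p\<bar> \<le> 1 \<and> \<bar>q\<bar> \<le> 1"
  proof (rule conjI; rule ccontr)
    assume "\<not> \<bar>p\<bar> \<le> 1"
    then have "2 * 2 \<le> \<bar>p\<bar> * \<bar>p\<bar>" by (intro mult_mono) auto
    then have "4 \<le> p * p" by simp
    then show False using n zero_le_square[of q] by linarith
  next
    assume "\<not> \<bar>q\<bar> \<le> 1"
    then have "2 * 2 \<le> \<bar>q\<bar> * \<bar>q\<bar>" by (intro mult_mono) auto
    then have "4 \<le> q * q" by simp
    then show False using n zero_le_square[of p] by linarith
  qed
  then have "p \<in> {-1,0,1}" "q \<in> {-1,0,1}" by auto
  then show ?thesis using n by (auto simp: ab)
qed

lemma cubic_norm_mult: "cubic_norm (a * b) = cubic_norm a * cubic_norm b"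
proof -
  obtain r s t where r: "cubic_root r" "cubic_root s" "cubic_root t"
    and v: "r + s + t = 1" "r * s + r * t + s * t = -2" "r * s * t = -1"
    by (rule cubic_roots_exist)
  have "real_of_int (cubic_norm (a * b)) = of_int (cubic_norm a) * of_int (cubic_norm b)"
    unfolding cubic_norm_prod[OF v, symmetric] by (simp add: cubic_at_mult r)
  then show ?thesis by (metis of_int_eq_iff of_int_mult)
qed

text \<open>The reduced norm of a unit is \<open>a + b\<close> with \<open>a\<close>, \<open>b\<close> zero or totally positive, and it has norm 1 over
  the rationals; but \<open>N (a + b) \<ge> N a + N b\<close>, and the norms of \<open>a\<close> and \<open>b\<close> are integers.\<close>

lemma quat_unit:
  assumes "a * Quat s t u v = 1"
  shows "(s = 0 \<and> t = 0) \<or> (u = 0 \<and> v = 0)"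
proof -
  obtain r1 r2 r3 where r: "cubic_root r1" "cubic_root r2" "cubic_root r3"
    and b: "\<bar>r1\<bar> < 2" "\<bar>r2\<bar> < 2" "\<bar>r3\<bar> < 2"
    and vi: "r1 + r2 + r3 = 1" "r1 * r2 + r1 * r3 + r2 * r3 = -2" "r1 * r2 * r3 = -1"
    by (rule cubic_roots_exist)
  let ?n = "\<lambda>s t. s * s + cubic_theta * (s * t) + t * t"
  have val: "cubic_at r (?n s t) = cubic_at r s * cubic_at r s + r * (cubic_at r s * cubic_at r t) +
      cubic_at r t * cubic_at r t" if "cubic_root r" for r s t
    using that by (simp add: cubic_at_add cubic_at_mult cubic_at_simps)
  \<comment> \<open>Completing the square leaves T^2 with the coefficient 1 - r^2/4, which is
    positive for |r| < 2.\<close>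
  have form: "0 \<le> S * S + r * (S * T) + T * T \<and> (S * S + r * (S * T) + T * T = 0 \<longrightarrow> S = 0 \<and> T = 0)"
    if "\<bar>r\<bar> < 2" for r S T :: real
  proof -
    have r2: "0 < 1 - r * r / 4" using that abs_square_less_1[of "r / 2"] by (simp add: power2_eq_square)
    have eq: "S * S + r * (S * T) + T * T = (S + r * T / 2)^2 + (1 - r * r / 4) * T^2"
      by (simp add: algebra_simps power2_eq_square)
    have "0 \<le> (1 - r * r / 4) * T^2" using r2 by simp
    moreover have "T = 0 \<and> S = 0" if "(S + r * T / 2)^2 + (1 - r * r / 4) * T^2 = 0"
    proof -
      have "(1 - r * r / 4) * T^2 = 0" "(S + r * T / 2)^2 = 0"
        using that \<open>0 \<le> (1 - r * r / 4) * T^2\<close> zero_le_power2[of "S + r * T / 2"] by linarith+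
      then show ?thesis using r2 by auto
    qed
    ultimately show ?thesis unfolding eq by auto
  qed
  have nonneg: "0 \<le> cubic_at r (?n s t)" if "cubic_root r" "\<bar>r\<bar> < 2" for r s t
    unfolding val[OF that(1)] using form[OF that(2)] by blast
  \<comment> \<open>A zero norm makes the form vanish at one real embedding; definiteness kills s
    and t there, so their own norms are 0.\<close>
  have vanish: "s = 0 \<and> t = 0" if z: "cubic_norm (?n s t) = 0" for s t
  proof -
    have "cubic_at r1 (?n s t) = 0 \<or> cubic_at r2 (?n s t) = 0 \<or> cubic_at r3 (?n s t) = 0"
      using cubic_norm_prod[OF vi, of "?n s t"] z by simp
    then obtain r' where r': "cubic_root r'" "\<bar>r'\<bar> < 2" "cubic_at r' (?n s t) = 0"
      and mem: "r' \<in> {r1, r2, r3}"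
      using r b by blast
    then have 0: "cubic_at r' s = 0" "cubic_at r' t = 0" using form[OF r'(2)] r'(3) unfolding val[OF r'(1)] by blast+
    have "of_int (cubic_norm s) = (0::real)" "of_int (cubic_norm t) = (0::real)"
      using 0 mem unfolding cubic_norm_prod[OF vi, symmetric] by auto
    then show ?thesis by (simp add: cubic_norm_eq_0)
  qed
  let ?x = "?n s t" and ?y = "?n u v"
  have q: "quat_norm (Quat s t u v) = ?x + ?y" by simp
  have "cubic_norm (quat_norm a) * cubic_norm (?x + ?y) = 1"
    using arg_cong[OF assms, of "\<lambda>q. cubic_norm (quat_norm q)"]
    by (simp only: quat_norm_mult cubic_norm_mult q quat_norm_1) (simp add: one_cubic_def cubic_norm.simps)
  then have "cubic_norm (?x + ?y) \<le> 1" by (auto simp: zmult_eq_1_iff)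
  moreover have "cubic_norm ?x + cubic_norm ?y \<le> cubic_norm (?x + ?y)"
  proof -
    have m: "X1 * X2 * X3 + Y1 * Y2 * Y3 \<le> (X1 + Y1) * (X2 + Y2) * (X3 + Y3)"
      if "0 \<le> X1" "0 \<le> X2" "0 \<le> X3" "0 \<le> Y1" "0 \<le> Y2" "0 \<le> Y3" for X1 X2 X3 Y1 Y2 Y3 :: real
      using that by (simp add: algebra_simps)
    have "real_of_int (cubic_norm ?x) + of_int (cubic_norm ?y) \<le> of_int (cubic_norm (?x + ?y))"
      unfolding cubic_norm_prod[OF vi, symmetric] cubic_at_add[of _ ?x]
      by (rule m) (intro nonneg r b)+
    then show ?thesis by linarith
  qed
  moreover have "0 \<le> cubic_norm ?x" "0 \<le> cubic_norm ?y"
  proof -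
    have "0 \<le> real_of_int (cubic_norm (?n s t))" for s t
      unfolding cubic_norm_prod[OF vi, symmetric] by (intro mult_nonneg_nonneg nonneg r b)
    then show "0 \<le> cubic_norm ?x" "0 \<le> cubic_norm ?y" by (simp_all del: of_int_0_le_iff add: of_int_0_le_iff[symmetric, where 'a=real])
  qed
  ultimately have "cubic_norm ?x = 0 \<or> cubic_norm ?y = 0" by linarith
  then show ?thesis using vanish by blast
qed

section \<open>The group ring of the quaternion group\<close>

text \<open>\<open>Q i b\<close> stands for \<open>x\<^sup>i\<close> or \<open>x\<^sup>i y\<close> in the quaternion group. It is written additively so that
  \<open>q28 \<Rightarrow>\<^sub>0 int\<close>, with its convolution product, is the integral group ring.\<close>

datatype q28 = Q 14 bool

lemma numeral_14: "(7::14) + 7 = 0" "- (7::14) = 7"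
  by simp_all

instantiation q28 :: group_add
begin
definition "0 = Q 0 False"
text \<open>Encodes y x^j = x^-j y and y^2 = x^7 with exponents modulo 14; hence the inverse of x^i
  y is x^(i+7) y.\<close>

fun plus_q28 where
  "Q i a + Q j b = Q (i + (if a then - j else j) + (if a \<and> b then 7 else 0)) (a \<noteq> b)"
fun uminus_q28 where "- Q i a = (if a then Q (i + 7) True else Q (- i) False)"
definition minus_q28 :: "q28 \<Rightarrow> q28 \<Rightarrow> q28" where "minus_q28 p q = p + - q"
instance
proof
  fix p q r :: q28
  show "p + q + r = p + (q + r)"
    using numeral_14 by (cases p; cases q; cases r) (auto simp: algebra_simps)
  show "0 + p = p" "p + 0 = p" "- p + p = 0" "p + - q = p - q"
    using numeral_14 by (cases p; auto simp: zero_q28_def minus_q28_def)+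
qed
end

lemma UNIV_q28: "(UNIV :: q28 set) = (\<lambda>(i, b). Q i b) ` UNIV"
  by (auto simp: image_iff) (metis q28.exhaust)

instance q28 :: finite
  by standard (simp add: UNIV_q28)

lemma card_q28: "card (UNIV :: q28 set) = 28"
proof -
  have "inj (\<lambda>(i, b). Q i b)" by (auto simp: inj_on_def)
  then show ?thesis unfolding UNIV_q28 by (simp add: card_image card_cartesian_product flip: UNIV_Times_UNIV)
qed

lemma of_nat_14_eq: "(of_nat m :: 14) = of_nat n \<longleftrightarrow> m mod 14 = n mod 14"
proof -
  have "int m mod 14 = int n mod 14 \<longleftrightarrow> m mod 14 = n mod 14"
    by (metis zmod_int of_nat_eq_iff of_nat_numeral)
  then show ?thesis
    by (simp add: bit0.of_nat_eq type_definition.Abs_inject[OF type_definition_bit0])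
qed

lemma of_nat_14_mod: "(of_nat (n mod 14) :: 14) = of_nat n"
  by (simp add: of_nat_14_eq)

lemma of_nat_14_surj: obtains n where "(i::14) = of_nat n"
proof (cases i)
  case (of_int z)
  then show ?thesis using that[of "nat z"] by simp
qed

lemma neg_of_nat_14: "(- of_nat j :: 14) = of_nat (13 * j)"
proof -
  have "(- 1 :: 14) = 13" by simp
  then have "(- of_nat j :: 14) = 13 * of_nat j" by (metis mult_minus1)
  then show ?thesis by simp
qed

section \<open>Homomorphisms from the quaternion group and its group ring\<close>

definition q28_map :: "'a::monoid_mult \<Rightarrow> 'a \<Rightarrow> q28 \<Rightarrow> 'a" where
  "q28_map x y p = (case p of Q i b \<Rightarrow> x ^ (LEAST n. of_nat n = i) * (if b then y else 1))"

text \<open>The relations avoid inverses, with x^13 in place of x^-1, so that they can be stated in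
  the multiplicative monoid of a ring.\<close>

definition q28_pair :: "'a::monoid_mult \<Rightarrow> 'a \<Rightarrow> bool" where
  "q28_pair x y \<longleftrightarrow> x ^ 14 = 1 \<and> y * y = x ^ 7 \<and> y * x = x ^ 13 * y"

text \<open>Since x^14 = 1, a power depends only on the exponent modulo 14, so the least exponent in
  \<open>q28_map\<close> may be replaced by any other.\<close>

lemma q28_map_of_nat:
  assumes "x ^ 14 = 1"
  shows "q28_map x y (Q (of_nat n) b) = x ^ n * (if b then y else 1)"
proof -
  have red: "x ^ m = x ^ (m mod 14)" for m
  proof -
    have "x ^ m = x ^ (14 * (m div 14) + m mod 14)" by simp
    also have "\<dots> = x ^ (m mod 14)" unfolding power_add power_mult assms by simp
    finally show ?thesis .
  qed
  define k where "k = (LEAST m. (of_nat m :: 14) = of_nat n)"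
  have "(of_nat k :: 14) = of_nat n" unfolding k_def by (rule LeastI) simp
  then have "x ^ k = x ^ n" using red[of k] red[of n] by (simp add: of_nat_14_eq)
  then show ?thesis by (simp add: q28_map_def k_def)
qed

lemma q28_map_add:
  assumes "q28_pair x y"
  shows "q28_map x y (p + q) = q28_map x y p * q28_map x y q"
proof -
  have a: "x ^ 14 = 1" "y * y = x ^ 7" "y * x = x ^ 13 * y" using assms by (auto simp: q28_pair_def)
  have yx: "y * x ^ n = x ^ (13 * n) * y" for n
  proof (induction n)
    case (Suc n)
    have "y * x ^ Suc n = (y * x ^ n) * x" by (simp add: power_Suc2 mult.assoc del: power_Suc)
    also have "\<dots> = x ^ (13 * n) * (y * x)" by (simp add: Suc mult.assoc)
    also have "\<dots> = x ^ (13 * Suc n) * y" by (simp add: a(3) mult.assoc[symmetric] power_add[symmetric] add.commute)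
    finally show ?case .
  qed simp
  obtain i b j c where pq: "p = Q (of_nat i) b" "q = Q (of_nat j) c"
    by (metis q28.exhaust of_nat_14_surj)
  have "p + q = Q (of_nat (i + (if b then 13 * j else j) + (if b \<and> c then 7 else 0))) (b \<noteq> c)"
    by (simp add: pq neg_of_nat_14)
  then have "q28_map x y (p + q) =
      x ^ (i + (if b then 13 * j else j) + (if b \<and> c then 7 else 0)) * (if b \<noteq> c then y else 1)"
    by (simp only: q28_map_of_nat[OF a(1)])
  also have "\<dots> = q28_map x y p * q28_map x y q"
  proof (cases b)
    case True
    have "y * (x ^ j * (if c then y else 1)) = x ^ (13 * j) * (if c then x ^ 7 else y)"
      using yx[of j] a(2) by (auto simp: mult.assoc[symmetric]) (simp add: mult.assoc)
    then show ?thesis using True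
      by (auto simp: pq q28_map_of_nat[OF a(1)] power_add mult.assoc split: if_splits)
  next
    case False
    then show ?thesis by (simp add: pq q28_map_of_nat[OF a(1)] power_add mult.assoc)
  qed
  finally show ?thesis .
qed

definition gr_lift :: "('g::finite \<Rightarrow> 'r::ring_1) \<Rightarrow> ('g \<Rightarrow>\<^sub>0 int) \<Rightarrow> 'r" where
  "gr_lift f c = (\<Sum>q\<in>UNIV. of_int (Poly_Mapping.lookup c q) * f q)"

lemma gr_lift_add: "gr_lift f (a + b) = gr_lift f a + gr_lift f b"
  by (simp add: gr_lift_def lookup_add distrib_right sum.distrib)

lemma gr_lift_diff: "gr_lift f (a - b) = gr_lift f a - gr_lift f b"
  by (simp add: gr_lift_def lookup_minus left_diff_distrib sum_subtractf)

lemma gr_lift_0: "gr_lift f 0 = 0"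
  by (simp add: gr_lift_def)

lemma gr_lift_of: "gr_lift f (frag_of q) = f q"
proof -
  have "gr_lift f (frag_of q) = (\<Sum>p\<in>UNIV. if p = q then f q else 0)"
    unfolding gr_lift_def by (intro sum.cong) (auto simp: lookup_single)
  then show ?thesis by simp
qed

lemma frag_induct_UNIV:
  assumes "P 0" "\<And>q. P (frag_of q)" "\<And>a b. P a \<Longrightarrow> P b \<Longrightarrow> P (a - b)"
  shows "P c"
  using frag_induction[of c UNIV P] assms by blast

lemma frag_of_mult: "frag_of p * frag_of q = frag_of (p + q)"
  by (simp add: mult_single)

lemma gr_lift_mult:
  fixes f :: "'g::{finite, monoid_add} \<Rightarrow> 'r::ring_1"
  assumes f: "\<And>p q. f (p + q) = f p * f q"
  shows "gr_lift f (a * b) = gr_lift f a * gr_lift f b"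
proof (induction a rule: frag_induct_UNIV)
  case (2 p)
  show ?case
    by (induction b rule: frag_induct_UNIV)
      (simp_all add: gr_lift_0 gr_lift_of gr_lift_diff frag_of_mult f right_diff_distrib)
qed (simp_all add: gr_lift_0 gr_lift_diff left_diff_distrib)

lemma gr_lift_comp:
  assumes h: "\<And>a b. h (a - b) = h a - h b"
  shows "h (gr_lift f c) = gr_lift (\<lambda>q. h (f q)) c"
proof -
  have "h 0 = 0" using h[of 0 0] by simp
  then show ?thesis
    by (induction c rule: frag_induct_UNIV) (simp_all add: gr_lift_0 gr_lift_of gr_lift_diff h)
qed

type_synonym lam = "q28 \<Rightarrow>\<^sub>0 int"

text \<open>Natural exponents reduce products in the group ring to arithmetic modulo 14, in which 13
  stands for -1.\<close>

definition rot :: "nat \<Rightarrow> lam" where "rot n = frag_of (Q (of_nat n) False)"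
definition flp :: "nat \<Rightarrow> lam" where "flp n = frag_of (Q (of_nat n) True)"

lemma q28_of_nat_add:
  "Q (of_nat i) b + Q (of_nat j) c =
    Q (of_nat ((i + (if b then 13 * j else j) + (if b \<and> c then 7 else 0)) mod 14)) (b \<noteq> c)"
  unfolding of_nat_14_mod by (simp add: neg_of_nat_14)

lemma rot_flp_mult:
  "rot m * rot n = rot ((m + n) mod 14)"
  "rot m * flp n = flp ((m + n) mod 14)"
  "flp m * rot n = flp ((m + 13 * n) mod 14)"
  "flp m * flp n = rot ((m + 13 * n + 7) mod 14)"
  unfolding rot_def flp_def frag_of_mult q28_of_nat_add by simp_all

lemma rot_0: "rot 0 = 1"
  by (simp add: rot_def zero_q28_def[symmetric] single_one)

lemma rot_flp_cases: obtains n where "frag_of q = rot n" | n where "frag_of q = flp n"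
proof (cases q)
  case (Q i b)
  obtain n where "i = of_nat n" by (rule of_nat_14_surj)
  then show ?thesis using that Q by (cases b) (auto simp: rot_def flp_def)
qed

lemma gr_lift_rot_flp:
  assumes "q28_pair x y"
  shows "gr_lift (q28_map x y) (rot n) = x ^ n" "gr_lift (q28_map x y) (flp n) = x ^ n * y"
  using assms by (simp_all add: rot_def flp_def gr_lift_of q28_map_of_nat q28_pair_def)

lemma gr_lift_q28_mult:
  assumes "q28_pair x y"
  shows "gr_lift (q28_map x y) (a * b) = gr_lift (q28_map x y) a * gr_lift (q28_map x y) b"
  by (rule gr_lift_mult) (rule q28_map_add[OF assms])

lemma gr_lift_of_int:
  assumes "q28_pair x y"
  shows "gr_lift (q28_map x y) (of_int k) = of_int k"
proof -
  have 1: "gr_lift (q28_map x y) 1 = 1"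
    using gr_lift_rot_flp(1)[OF assms, of 0] by (simp add: rot_0)
  have n: "gr_lift (q28_map x y) (of_nat n) = of_nat n" for n
    by (induction n) (simp_all add: gr_lift_0 gr_lift_add 1)
  show ?thesis
  proof (cases k)
    case (nonneg n)
    then show ?thesis by (simp add: n)
  next
    case (neg n)
    then have "gr_lift (q28_map x y) (of_int k) = gr_lift (q28_map x y) (0 - of_nat (Suc n))" by simp
    then show ?thesis unfolding gr_lift_diff n gr_lift_0 by (simp add: neg)
  qed
qed

section \<open>The norm element of the subgroup generated by x, and the elements fixed by x on the
  right\<close>

definition rot_sum :: lam where "rot_sum = (\<Sum>n<14. rot n)"

lemma sum_lessThan_14: "(\<Sum>n<14::nat. f n) = f 0 + f 1 + f 2 + f 3 + f 4 + f 5 + f 6 + f 7 + f 8 + f 9 +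
    f 10 + f 11 + f 12 + (f 13 :: 'a::comm_monoid_add)"
proof -
  have "(\<Sum>n<14::nat. f n) = sum_list (map f [0..<14])"
    by (simp add: interv_sum_list_conv_sum_set_nat atLeast0LessThan)
  also have "[0..<14] = [0, 1, 2, 3, 4, 5, 6, 7, 8, 9, 10, 11, 12, 13]"
    by (simp add: upt_rec)
  finally show ?thesis by (simp add: add.assoc)
qed

text \<open>Modulo the left ideal of x - 1, each x^n becomes 1 and each x^n y = y x^-n becomes y, so
  only two integers survive.\<close>

lemma coset_decomp: "\<exists>\<alpha> \<beta> e. c = of_int \<alpha> + of_int \<beta> * flp 0 + e * (rot 1 - 1)"
proof (induction c rule: frag_induct_UNIV)
  case 1
  show ?case by (rule exI[of _ 0], rule exI[of _ 0], rule exI[of _ 0]) simp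
next
  case (2 q)
  have r: "\<exists>e. rot n = 1 + e * (rot 1 - 1)" for n
  proof (induction n)
    case 0 then show ?case by (intro exI[of _ 0]) (simp add: rot_0)
  next
    case (Suc n)
    then obtain e where e: "rot n = 1 + e * (rot 1 - 1)" by auto
    have "rot (Suc n) = rot n * rot 1" by (simp add: rot_flp_mult) (metis of_nat_14_mod rot_def)
    also have "\<dots> = 1 + (rot n + e) * (rot 1 - 1)" by (simp add: e algebra_simps)
    finally show ?case by blast
  qed
  show ?case
  proof (cases rule: rot_flp_cases[of q])
    case (1 n)
    obtain e where e: "rot n = 1 + e * (rot 1 - 1)" using r by blast
    show ?thesis unfolding 1 by (rule exI[of _ 1], rule exI[of _ 0], rule exI[of _ e]) (simp add: e)
  next
    case (2 n)
    obtain e where e: "rot (13 * n) = 1 + e * (rot 1 - 1)" using r by blast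
    have "flp n = flp 0 * rot (13 * n)"
    proof -
      \<comment> \<open>Moving x past y twice restores the exponent: 13 * 13 = 12 * 14 + 1.\<close>
      have "(0 + 13 * (13 * n)) mod 14 = n mod 14" using mod_mult_self2[of n 14 "12 * n"] by simp
      then show ?thesis
        unfolding rot_flp_mult unfolding flp_def using of_nat_14_mod[of "13 * (13 * n)"] of_nat_14_mod[of n] by simp
    qed
    also have "\<dots> = flp 0 + flp 0 * e * (rot 1 - 1)"
      unfolding e by (simp only: distrib_left mult.assoc mult_1_right)
    finally have *: "flp n = flp 0 + flp 0 * e * (rot 1 - 1)" .
    show ?thesis unfolding 2
      by (rule exI[of _ 0], rule exI[of _ 1], rule exI[of _ "flp 0 * e"]) (simp add: * del: One_nat_def)
  qed
next
  case (3 a b)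
  then obtain i j e i' j' e' where ab: "a = of_int i + of_int j * flp 0 + e * (rot 1 - 1)"
    "b = of_int i' + of_int j' * flp 0 + e' * (rot 1 - 1)" by blast
  show ?case
    unfolding ab by (rule exI[of _ "i - i'"], rule exI[of _ "j - j'"], rule exI[of _ "e - e'"]) (simp add: algebra_simps)
qed

lemma lookup_of_int_mult: "Poly_Mapping.lookup (of_int k * c :: lam) q = k * Poly_Mapping.lookup c q"
proof -
  have n: "Poly_Mapping.lookup (of_nat n * c :: lam) q = int n * Poly_Mapping.lookup c q" for n
    by (induction n) (simp_all add: lookup_add distrib_right)
  show ?thesis by (cases k) (simp_all add: n distrib_right lookup_minus lookup_add del: of_nat_Suc)
qed

lemma lam_of_int_cancel:
  fixes a b :: lam
  assumes "of_int k * a = of_int k * b" "k \<noteq> 0"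
  shows "a = b"
proof (rule poly_mapping_eqI)
  fix q
  have "k * Poly_Mapping.lookup a q = k * Poly_Mapping.lookup b q"
    using assms(1) by (metis lookup_of_int_mult)
  then show "Poly_Mapping.lookup a q = Poly_Mapping.lookup b q" using assms(2) by simp
qed

lemma rot_sum_absorb: "rot 1 * rot_sum = rot_sum" "flp 0 * rot_sum = rot_sum * flp 0" "rot 7 * rot_sum = rot_sum"
   "rot_sum * rot 7 = rot_sum"
  by (simp_all add: rot_sum_def sum_lessThan_14 algebra_simps rot_flp_mult flip: numeral_2_eq_2 del: One_nat_def)

lemma lookup_rot_flp:
  "Poly_Mapping.lookup (rot n) (Q 0 False) = (if n mod 14 = 0 then 1 else 0)"
  "Poly_Mapping.lookup (rot n) (Q 0 True) = 0"
  "Poly_Mapping.lookup (flp n) (Q 0 False) = 0"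
  "Poly_Mapping.lookup (flp n) (Q 0 True) = (if n mod 14 = 0 then 1 else 0)"
  using of_nat_14_eq[of n 0] by (auto simp: rot_def flp_def lookup_single)

text \<open>Invariance gives 14 w = w * \<open>rot_sum\<close>, and \<open>coset_decomp\<close>
  turns the right side into (alpha + beta y) * \<open>rot_sum\<close>. Comparing coefficients at 1
  and y shows that 14 divides alpha and beta.\<close>

lemma rot_invariant:
  fixes w :: lam
  assumes "w * rot 1 = w"
  shows "\<exists>\<alpha> \<beta>. w = (of_int \<alpha> + of_int \<beta> * flp 0) * rot_sum"
proof -
  have inv: "w * rot n = w" for n
  proof (induction n)
    case (Suc n)
    have "w * rot (Suc n) = w * rot n * rot 1"
      by (simp add: mult.assoc rot_flp_mult) (metis of_nat_14_mod rot_def)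
    then show ?case using Suc assms by simp
  qed (simp add: rot_0)
  have 14: "w * rot_sum = of_int 14 * w"
    by (simp add: rot_sum_def sum_distrib_left inv)
  obtain \<alpha> \<beta> e where w: "w = of_int \<alpha> + of_int \<beta> * flp 0 + e * (rot 1 - 1)" using coset_decomp by blast
  have "(rot 1 - 1) * rot_sum = 0" by (simp add: left_diff_distrib rot_sum_absorb del: One_nat_def)
  then have "w * rot_sum = (of_int \<alpha> + of_int \<beta> * flp 0) * rot_sum"
    by (simp add: w distrib_right mult.assoc)
  then have eq: "of_int 14 * w = (of_int \<alpha> + of_int \<beta> * flp 0) * rot_sum" by (simp only: 14)
  then have eq': "of_int 14 * w = of_int \<alpha> * rot_sum + of_int \<beta> * (flp 0 * rot_sum)"
    by (simp only: distrib_right mult.assoc)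
  have l: "Poly_Mapping.lookup rot_sum (Q 0 False) = 1" "Poly_Mapping.lookup rot_sum (Q 0 True) = 0"
    "Poly_Mapping.lookup (flp 0 * rot_sum) (Q 0 False) = 0" "Poly_Mapping.lookup (flp 0 * rot_sum) (Q 0 True) = 1"
    by (simp_all add: rot_sum_def sum_lessThan_14 distrib_left rot_flp_mult lookup_add lookup_rot_flp)
  have "14 * Poly_Mapping.lookup w (Q 0 False) = \<alpha>" "14 * Poly_Mapping.lookup w (Q 0 True) = \<beta>"
    using arg_cong[OF eq', of "\<lambda>c. Poly_Mapping.lookup c (Q 0 False)"]
      arg_cong[OF eq', of "\<lambda>c. Poly_Mapping.lookup c (Q 0 True)"]
    by (simp_all only: lookup_of_int_mult lookup_add l mult_1_right mult_zero_right add_0_right add_0_left)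
  then obtain \<alpha>' \<beta>' where ab: "\<alpha> = 14 * \<alpha>'" "\<beta> = 14 * \<beta>'" by metis
  then have "of_int 14 * w = of_int 14 * ((of_int \<alpha>' + of_int \<beta>' * flp 0) * rot_sum)"
    unfolding eq ab by (simp only: of_int_mult distrib_left distrib_right mult.assoc)
  from lam_of_int_cancel[OF this] show ?thesis by auto
qed

section \<open>Cycles of the two presentations\<close>

text \<open>\<open>std_solution c d\<close> says that the chain with coefficients \<open>c\<close>, \<open>d\<close> on the two relators of the standard
  presentation is a cycle; the coefficients on the right are the Fox derivatives of the relators.\<close>

definition std_solution :: "lam \<Rightarrow> lam \<Rightarrow> bool" where
  "std_solution c d \<longleftrightarrow>
    c * (rot 7 + rot 8 + rot 9 + rot 10 + rot 11 + rot 12 + rot 13) = d * (rot 13 + flp 7) \<and>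
    c * (rot 7 + flp 7) = d * (flp 7 - flp 6)"

lemma std_solution_diff:
  "std_solution a b \<Longrightarrow> std_solution c d \<Longrightarrow> std_solution (a - c) (b - d)"
  by (simp add: std_solution_def left_diff_distrib)

lemma std_solution_mult:
  assumes "std_solution c d" shows "std_solution (a * c) (a * d)"
  using assms unfolding std_solution_def mult.assoc by simp

lemma std_solution_gen: "std_solution (rot 8 - rot 7) (rot 8 - flp 0)"
  by (simp add: std_solution_def algebra_simps rot_flp_mult flip: numeral_2_eq_2 del: One_nat_def)

section \<open>Cyclicity of the standard cycles\<close>

definition augment :: "int \<Rightarrow> lam \<Rightarrow> int" where
  "augment s = gr_lift (q28_map 1 s)"

lemma augment_simps:
  assumes "s = 1 \<or> s = -1"
  shows "augment s (a * b) = augment s a * augment s b" "augment s (a + b) = augment s a + augment s b"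
    "augment s (a - b) = augment s a - augment s b"
    "augment s (of_int k) = k" "augment s (rot n) = 1" "augment s (flp n) = s" "augment s 0 = 0"
    "augment s rot_sum = 14"
proof -
  have p: "q28_pair (1::int) s" using assms by (auto simp: q28_pair_def)
  show "augment s (a * b) = augment s a * augment s b" "augment s (a + b) = augment s a + augment s b"
    "augment s (a - b) = augment s a - augment s b"
    "augment s (of_int k) = k" "augment s (flp n) = s" "augment s 0 = 0"
    by (simp_all add: augment_def gr_lift_q28_mult[OF p] gr_lift_add gr_lift_diff gr_lift_0
        gr_lift_rot_flp[OF p] gr_lift_of_int[OF p])
  show r: "augment s (rot n) = 1" for n by (simp add: augment_def gr_lift_rot_flp[OF p])
  show "augment s rot_sum = 14"
    unfolding rot_sum_def sum_lessThan_14
    by (simp only: augment_def gr_lift_add r[unfolded augment_def])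
qed

text \<open>Subtracting a multiple of the generator leaves alpha + beta y as first coefficient,
  which two augmentations force to 0. The second coefficient is then h (1 - y) times the norm
  element, again a multiple of the generator.\<close>

lemma std_solution_cyclic:
  assumes "std_solution c d"
  shows "\<exists>a. c = a * (rot 8 - rot 7) \<and> d = a * (rot 8 - flp 0)"
proof -
  obtain \<alpha> \<beta> e where c: "c = of_int \<alpha> + of_int \<beta> * flp 0 + e * (rot 1 - 1)" using coset_decomp by blast
  define a where "a = e * rot 7"
  define c' where "c' = c - a * (rot 8 - rot 7)"
  define d' where "d' = d - a * (rot 8 - flp 0)"
  have sol: "std_solution c' d'"
    unfolding c'_def d'_def by (intro std_solution_diff assms std_solution_mult std_solution_gen)
  have "a * (rot 8 - rot 7) = e * (rot 7 * (rot 8 - rot 7))" by (simp add: a_def mult.assoc)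
  also have "rot 7 * (rot 8 - rot 7) = rot 1 - 1"
    by (simp add: algebra_simps rot_flp_mult rot_0 flip: numeral_2_eq_2 del: One_nat_def)
  finally have c': "c' = of_int \<alpha> + of_int \<beta> * flp 0" by (simp add: c'_def c)
  have s: "c' * (rot 7 + rot 8 + rot 9 + rot 10 + rot 11 + rot 12 + rot 13) = d' * (rot 13 + flp 7)"
    "c' * (rot 7 + flp 7) = d' * (flp 7 - flp 6)"
    using sol by (simp_all add: std_solution_def)
  note au = augment_simps[of 1, simplified] augment_simps[of "-1", simplified]
  \<comment> \<open>Sending x to 1 and y to -1 kills the right side of the first equation; sending
    both to 1 kills that of the second.\<close>
  have "\<alpha> - \<beta> = 0" using arg_cong[OF s(1), of "augment (-1)"] by (simp add: c' au)
  moreover have "\<alpha> + \<beta> = 0" using arg_cong[OF s(2), of "augment 1"] by (simp add: c' au)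
  ultimately have c'0: "c' = 0" by (simp add: c')
  \<comment> \<open>With c' = 0, right multiplication by group elements turns the second equation
    into d' (x - 1) = 0.\<close>
  have "d' * rot 1 = d'"
  proof -
    have "d' * (flp 7 - flp 6) * flp 7 = 0" using s(2) c'0 by simp
    then have "d' * ((flp 7 - flp 6) * flp 7) = 0" by (simp add: mult.assoc)
    moreover have "(flp 7 - flp 6) * flp 7 = rot 7 - rot 6"
      by (simp add: algebra_simps rot_flp_mult flip: numeral_2_eq_2 del: One_nat_def)
    ultimately have "d' * (rot 7 - rot 6) * rot 8 = 0" by simp
    then have "d' * ((rot 7 - rot 6) * rot 8) = 0" by (simp add: mult.assoc)
    moreover have "(rot 7 - rot 6) * rot 8 = rot 1 - 1"
      by (simp add: algebra_simps rot_flp_mult rot_0 flip: numeral_2_eq_2 del: One_nat_def)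
    ultimately show ?thesis by (simp add: right_diff_distrib del: One_nat_def)
  qed
  then obtain h k where d': "d' = (of_int h + of_int k * flp 0) * rot_sum" using rot_invariant by blast
  \<comment> \<open>The augmentation of the first equation reads 0 = 28 (h + k).\<close>
  have "h + k = 0" using arg_cong[OF s(1), of "augment 1"] by (simp add: c'0 d' au)
  then have k: "k = - h" by simp
  have eq: "of_int h * rot_sum * (rot 8 - rot 7) = 0" "of_int h * rot_sum * (rot 8 - flp 0) = d'"
  proof -
    have "rot_sum * (rot 8 - rot 7) = 0" "rot_sum * (rot 8 - flp 0) = rot_sum - flp 0 * rot_sum"
      by (simp_all add: rot_sum_def sum_lessThan_14 algebra_simps rot_flp_mult flip: numeral_2_eq_2 del: One_nat_def)
    then show "of_int h * rot_sum * (rot 8 - rot 7) = 0" "of_int h * rot_sum * (rot 8 - flp 0) = d'"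
      unfolding mult.assoc by (simp_all add: d' k distrib_right right_diff_distrib left_diff_distrib mult.assoc)
  qed
  have "c = (a + of_int h * rot_sum) * (rot 8 - rot 7)"
    using c'0 unfolding distrib_right eq by (simp add: c'_def)
  moreover have "d = (a + of_int h * rot_sum) * (rot 8 - flp 0)"
    unfolding distrib_right eq by (simp add: d'_def)
  ultimately show ?thesis by blast
qed

text \<open>The second exotic relator has the Fox derivatives of the second standard one, multiplied on the
  left by \<open>x\<^sup>-\<^sup>1 (1 - x\<^sup>2 - x\<^sup>3)\<close>; see \<open>exotic_fox\<close>.\<close>

definition exo_factor :: lam where "exo_factor = rot 13 - rot 1 - rot 2"

definition exo_solution :: "lam \<Rightarrow> lam \<Rightarrow> bool" where
  "exo_solution c d \<longleftrightarrow> std_solution c (d * exo_factor)"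

lemma exo_solutionI:
  assumes "d * exo_factor = a * (rot 8 - flp 0)"
  shows "exo_solution (a * (rot 8 - rot 7)) d"
  unfolding exo_solution_def assms by (intro std_solution_mult std_solution_gen)

text \<open>Two cycles, chosen so that \<open>wit_a\<close> maps to \<open>1 + x y\<close> in the quaternion order and \<open>wit_b\<close> maps to 1 in
  the Gaussian integers. Here \<open>wit_a'\<close> and \<open>wit_b'\<close> are the coefficients on the second relator.\<close>

definition wit_a :: lam where
  "wit_a = rot 0 + flp 1 + flp 3 - flp 5 - flp 6 + flp 10 - flp 12 - flp 13"
definition wit_b :: lam where
  "wit_b = rot 0 + flp 0 + flp 1 - flp 3 - flp 4 - flp 5 - flp 6 + flp 8 + flp 9"
definition wit_a' :: lam where
  "wit_a' = flp 1 + flp 6 - flp 11 + flp 12 - rot 4 - rot 11"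
definition wit_b' :: lam where
  "wit_b' = rot 0 - rot 8 - rot 10 + flp 0 - flp 8 + flp 12"

lemma wit_solution:
  "exo_solution (wit_a * (rot 8 - rot 7)) wit_a'"
  "exo_solution (wit_b * (rot 8 - rot 7)) wit_b'"
  by (rule exo_solutionI; simp add: wit_a_def wit_a'_def wit_b_def wit_b'_def exo_factor_def
      algebra_simps rot_flp_mult flip: numeral_2_eq_2 del: One_nat_def)+

section \<open>Representations in the quaternion order and the Gaussian integers, and their common
  reduction\<close>

definition quat_x :: quat where "quat_x = Quat 0 1 0 0"
definition quat_y :: quat where "quat_y = Quat 0 0 1 0"
definition to_quat :: "lam \<Rightarrow> quat" where "to_quat = gr_lift (q28_map quat_x quat_y)"
definition gauss_x :: "'a::comm_ring_1 gauss" where "gauss_x = Gauss (-1) 0"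
definition gauss_y :: "'a::comm_ring_1 gauss" where "gauss_y = Gauss 0 1"
text \<open>The base ring is left open: \<open>int\<close> gives the Gaussian integers,
  \<open>7\<close> the residue field.\<close>

definition to_gauss :: "lam \<Rightarrow> 'a::comm_ring_1 gauss" where "to_gauss = gr_lift (q28_map gauss_x gauss_y)"

lemmas quat_simps = zero_quat_def one_quat_def zero_cubic_def one_cubic_def cubic_theta_def

lemma quat_pair: "q28_pair quat_x quat_y"
  unfolding q28_pair_def
  by (simp add: quat_x_def quat_y_def eval_nat_numeral quat_simps)

lemma gauss_pair: "q28_pair gauss_x gauss_y"
  unfolding q28_pair_def
  by (simp add: gauss_x_def gauss_y_def eval_nat_numeral one_gauss_def)

text \<open>Reduction of the quaternion order modulo its prime above 7, with residue field \<open>7 gauss\<close> of order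
  49; it sends \<open>x\<close> to \<open>-1\<close>, so \<open>\<theta>\<close> to \<open>-2\<close>.\<close>

fun cubic_mod :: "cubic \<Rightarrow> 7" where
  "cubic_mod (Cubic a b c) = of_int (a - 2 * b + 4 * c)"

fun quat_mod :: "quat \<Rightarrow> 7 gauss" where
  "quat_mod (Quat s t u v) = Gauss (cubic_mod s - cubic_mod t) (cubic_mod u - cubic_mod v)"

lemma cubic_mod_hom:
  "cubic_mod (a + b) = cubic_mod a + cubic_mod b" "cubic_mod (a - b) = cubic_mod a - cubic_mod b"
  "cubic_mod (a * b) = cubic_mod a * cubic_mod b" "cubic_mod 0 = 0" "cubic_mod 1 = 1"
  "cubic_mod cubic_theta = -2"
proof -
  show "cubic_mod (a + b) = cubic_mod a + cubic_mod b" "cubic_mod (a - b) = cubic_mod a - cubic_mod b"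
    by (cases a; cases b; simp add: algebra_simps)+
  have "(7 :: 7) = 0" by simp
  then have 7: "7 * x = 0" for x :: 7 by (metis mult_zero_left)
  show "cubic_mod (a * b) = cubic_mod a * cubic_mod b"
  proof (cases a; cases b)
    fix a1 a2 a3 b1 b2 b3
    assume ab: "a = Cubic a1 a2 a3" "b = Cubic b1 b2 b3"
    \<comment> \<open>At -2 the cubic t^3 - t^2 - 2 t + 1 has the value -7, so multiplicativity
      holds only modulo 7; the last summand is the discrepancy.\<close>
    have "cubic_mod (a * b) = of_int ((a1 - 2 * a2 + 4 * a3) * (b1 - 2 * b2 + 4 * b3) +
        7 * (a2 * b3 + a3 * b2 - a3 * b3))"
      unfolding ab times_cubic.simps cubic_mod.simps
      by (rule arg_cong[where f = of_int]) (simp add: algebra_simps)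
    then show ?thesis
      unfolding ab cubic_mod.simps of_int_add[of _ "7 * _"] of_int_mult of_int_numeral 7 by simp
  qed
qed (simp_all add: zero_cubic_def one_cubic_def cubic_theta_def)

lemma quat_mod_diff: "quat_mod (a - b) = quat_mod a - quat_mod b"
  by (cases a; cases b) (simp add: cubic_mod_hom)

lemma quat_mod_1: "quat_mod 1 = 1"
  by (simp add: one_quat_def one_gauss_def cubic_mod_hom)

lemma quat_mod_mult: "quat_mod (a * b) = quat_mod a * quat_mod b"
  by (cases a; cases b) (simp add: cubic_mod_hom algebra_simps)

lemma quat_mod_power: "quat_mod (a ^ n) = quat_mod a ^ n"
  by (induction n) (simp_all add: quat_mod_1 quat_mod_mult)

text \<open>Together with \<open>gauss_mod_to_gauss\<close> this gives the quaternion and Gaussian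
  images of an element the same residue. Both sides are additive, so group elements suffice.\<close>

lemma quat_mod_to_quat: "quat_mod (to_quat c) = to_gauss c"
proof -
  have "quat_mod (q28_map quat_x quat_y p) = q28_map gauss_x gauss_y p" for p
    by (cases p) (auto simp: q28_map_def quat_mod_mult quat_mod_power quat_mod_1,
      simp_all add: quat_x_def quat_y_def gauss_x_def gauss_y_def cubic_mod_hom)
  then show ?thesis
    unfolding to_quat_def to_gauss_def by (simp add: gr_lift_comp[of quat_mod] quat_mod_diff)
qed

fun gauss_mod :: "int gauss \<Rightarrow> 7 gauss" where
  "gauss_mod (Gauss a b) = Gauss (of_int a) (of_int b)"

lemma gauss_mod_to_gauss: "gauss_mod (to_gauss c) = to_gauss c"
proof -
  have m: "gauss_mod (a * b) = gauss_mod a * gauss_mod b" for a b by (cases a; cases b) simp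
  have 1: "gauss_mod 1 = 1" by (simp add: one_gauss_def)
  have p: "gauss_mod (a ^ n) = gauss_mod a ^ n" for a n by (induction n) (simp_all add: 1 m)
  have d: "gauss_mod (a - b) = gauss_mod a - gauss_mod b" for a b by (cases a; cases b) simp
  have "gauss_mod (q28_map gauss_x gauss_y p) = q28_map gauss_x gauss_y p" for p
    by (cases p) (auto simp: q28_map_def m p 1, simp_all add: gauss_x_def gauss_y_def)
  then show ?thesis
    unfolding to_gauss_def by (simp add: gr_lift_comp[of gauss_mod] d)
qed

lemma to_quat_simps:
  "to_quat (a * b) = to_quat a * to_quat b" "to_quat (a + b) = to_quat a + to_quat b"
  "to_quat (a - b) = to_quat a - to_quat b"
  "to_quat (rot n) = quat_x ^ n" "to_quat (flp n) = quat_x ^ n * quat_y"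
  by (simp_all add: to_quat_def gr_lift_q28_mult[OF quat_pair] gr_lift_add gr_lift_diff
      gr_lift_rot_flp[OF quat_pair])

lemma to_gauss_simps:
  "to_gauss (a * b) = to_gauss a * to_gauss b" "to_gauss (a + b) = to_gauss a + to_gauss b"
  "to_gauss (a - b) = to_gauss a - to_gauss b"
  "to_gauss (rot n) = gauss_x ^ n" "to_gauss (flp n) = gauss_x ^ n * gauss_y"
  by (simp_all add: to_gauss_def gr_lift_q28_mult[OF gauss_pair] gr_lift_add gr_lift_diff
      gr_lift_rot_flp[OF gauss_pair])

section \<open>The exotic cycles are not generated by one element\<close>

lemma exo_not_cyclic:
  assumes sol: "exo_solution c d"
    and gen: "\<And>c' d'. exo_solution c' d' \<Longrightarrow> \<exists>r. c' = r * c \<and> d' = r * d"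
  shows False
proof -
  \<comment> \<open>The standard classification applied to the pair of c and d *
    \<open>exo_factor\<close>.\<close>
  obtain a where c: "c = a * (rot 8 - rot 7)" and d: "d * exo_factor = a * (rot 8 - flp 0)"
    using sol std_solution_cyclic unfolding exo_solution_def by blast
  obtain r where r: "wit_a * (rot 8 - rot 7) = r * c" using gen wit_solution(1) by blast
  obtain s where s: "wit_b * (rot 8 - rot 7) = s * c" using gen wit_solution(2) by blast
  define g where "g = 1 + quat_x * quat_y"
  define M :: quat where "M = to_quat exo_factor"
  define V :: quat where "V = to_quat (rot 8 - flp 0)"
  define W :: quat where "W = to_quat (rot 8 - rot 7)"
  note nums = g_def M_def V_def W_def exo_factor_def wit_a_def to_quat_simps quat_x_def quat_y_def eval_nat_numeral quat_simps
  \<comment> \<open>As x^7 maps to -1, \<open>W\<close> is 1 - x and the product telescopes to 1 -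
    x^7 = 2.\<close>
  have W: "W * (\<Sum>i<7. quat_x ^ i) = 1 + 1"
    by (simp add: nums)
  have "to_quat wit_a = to_quat r * to_quat a"
  proof -
    have "to_quat wit_a * W = to_quat r * to_quat a * W"
      using arg_cong[OF r, of to_quat] by (simp add: to_quat_simps c W_def mult.assoc)
    then have "to_quat wit_a * (W * (\<Sum>i<7. quat_x ^ i)) = to_quat r * to_quat a * (W * (\<Sum>i<7. quat_x ^ i))"
      by (simp only: mult.assoc[symmetric])
    then show ?thesis unfolding W by (simp only: distrib_left mult_1_right) (rule quat_double_cancel)
  qed
  moreover have "to_quat wit_a = g" by (simp add: nums)
  ultimately have ra: "to_quat r * to_quat a = g" by simp
  \<comment> \<open>The cycle condition forces \<open>a\<close> into the left ideal generated by \<open>g\<close>, and \<open>A\<close> is the quotient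
    \<open>a g\<^sup>-\<^sup>1\<close>. The coefficients \<open>P\<close> and \<open>R\<close> are a Bezout certificate for its integrality.\<close>
  define P :: quat where "P = Quat (Cubic 0 0 0) (Cubic 1 0 0) (Cubic 1 (-1) (-1)) (Cubic 0 0 1)"
  define R :: quat where "R = Quat (Cubic 1 0 (-1)) (Cubic (-2) 0 1) (Cubic 1 1 0) (Cubic (-1) 0 0)"
  \<comment> \<open>Twice the inverse of \<open>M\<close>, as \<open>MM\<close> confirms; it solves
    the cycle condition for the image of 2 d.\<close>
  define M' :: quat where "M' = quat_x - quat_x ^ 2 + quat_x ^ 3 + quat_x ^ 6"
  define A where "A = to_quat a * P + to_quat d * R"
  have MM: "M * M' = 1 + 1" by (simp add: nums M'_def)
  \<comment> \<open>By \<open>dd\<close>, the image of a times the left factor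
    \<open>P + P + V * M' * R\<close> is 2 A, so this identity yields
    \<open>A * g = to_quat a\<close>.\<close>
  have key: "(P + P + V * M' * R) * g = 1 + 1" by (simp add: nums M'_def P_def R_def)
  have dd: "to_quat d + to_quat d = to_quat a * (V * M')"
  proof -
    have "to_quat d * M = to_quat a * V"
      using arg_cong[OF d, of to_quat] by (simp add: to_quat_simps M_def V_def)
    then have "to_quat d * (M * M') = to_quat a * (V * M')" by (simp add: mult.assoc[symmetric])
    then show ?thesis unfolding MM distrib_left mult_1_right .
  qed
  have "A * g + A * g = to_quat a * ((P + P) * g) + (to_quat d + to_quat d) * (R * g)"
    by (simp add: A_def algebra_simps)
  also have "\<dots> = to_quat a * ((P + P + V * M' * R) * g)"
    unfolding dd by (simp add: algebra_simps)
  also have "\<dots> = to_quat a + to_quat a" unfolding key distrib_left mult_1_right ..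
  finally have Ag: "A * g = to_quat a" by (rule quat_double_cancel)
  have "to_quat r * A * g = g" by (simp add: Ag ra mult.assoc)
  then have "to_quat r * A * (g * (1 - quat_x * quat_y)) = g * (1 - quat_x * quat_y)"
    by (simp only: mult.assoc[symmetric])
  \<comment> \<open>Since (x y)^2 = -1, the factor 1 - x y inverts g up to 2, and g can be cancelled
    on the right.\<close>
  moreover have "g * (1 - quat_x * quat_y) = 1 + 1" by (simp add: nums)
  ultimately have "to_quat r * A = 1"
    by (metis quat_double_cancel distrib_left mult_1_right)
  obtain s' t u v where A: "A = Quat s' t u v" by (cases A)
  have unit: "(s' = 0 \<and> t = 0) \<or> (u = 0 \<and> v = 0)" using quat_unit \<open>to_quat r * A = 1\<close> unfolding A .
  \<comment> \<open>At x = -1 the factor x^8 - x^7 is 2 and \<open>wit_b\<close> maps to 1;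
    cancelling 2 makes the image of a a unit.\<close>
  have "to_gauss s * to_gauss a = (1 :: int gauss)"
  proof -
    have w: "to_gauss (rot 8 - rot 7) = (Gauss 2 0 :: int gauss)" "to_gauss wit_b = (1 :: int gauss)"
      by (simp_all add: wit_b_def to_gauss_simps gauss_x_def gauss_y_def eval_nat_numeral one_gauss_def)
    have "Gauss 2 0 = to_gauss s * to_gauss a * (Gauss 2 0 :: int gauss)"
      using arg_cong[OF s, of "to_gauss :: lam \<Rightarrow> int gauss"] by (simp add: to_gauss_simps(1) c w mult.assoc)
    then show ?thesis by (cases "to_gauss s * to_gauss a :: int gauss") (simp add: one_gauss_def)
  qed
  then have ga: "to_gauss a \<in> {Gauss 1 0, Gauss (-1) 0, Gauss 0 1, Gauss 0 (-1 :: int)}"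
    by (rule gauss_unit)
  have "quat_mod A * Gauss 1 (-1) = gauss_mod (to_gauss a)"
  proof -
    have "quat_mod g = Gauss 1 (-1)" by (simp add: nums)
    then show ?thesis unfolding gauss_mod_to_gauss quat_mod_to_quat[symmetric] Ag[symmetric] quat_mod_mult
      by simp
  qed
  \<comment> \<open>The left side has two nonzero components and the right side only one.\<close>
  then show False using unit ga by (auto simp: A cubic_mod_hom)
qed

section \<open>The presented groups\<close>

text \<open>Conjugation by y inverts x but fixes x^7 = y^2, so x^14 = 1 and x^13 serves as the
  inverse of x.\<close>

lemma (in group) quaternion_relations:
  assumes x: "x \<in> carrier G" and y: "y \<in> carrier G"
    and xyx: "x \<otimes> y \<otimes> x = y" and yy: "y \<otimes> y = x [^] (7::nat)"
  shows "x [^] (14::nat) = \<one>" "y \<otimes> x [^] (n::nat) = x [^] (13 * n) \<otimes> y"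
proof -
  have yx: "y \<otimes> x = inv x \<otimes> y"
    using xyx x y by (metis inv_closed l_inv l_one m_assoc m_closed)
  have inv_pow: "y \<otimes> x [^] (m::nat) = inv (x [^] m) \<otimes> y" for m
  proof (induction m)
    case 0 then show ?case using x y by simp
  next
    case (Suc m)
    have "y \<otimes> x [^] Suc m = (y \<otimes> x [^] m) \<otimes> x" using x y by (simp add: m_assoc)
    also have "\<dots> = inv (x [^] m) \<otimes> (y \<otimes> x)" unfolding Suc using x y by (simp add: m_assoc)
    also have "\<dots> = inv (x [^] m) \<otimes> inv x \<otimes> y" unfolding yx using x y by (simp add: m_assoc)
    also have "\<dots> = inv (x [^] Suc m) \<otimes> y"
      using x y by (metis inv_mult_group nat_pow_Suc2 nat_pow_closed)
    finally show ?case .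
  qed
  have "x [^] (7::nat) \<otimes> y = inv (x [^] (7::nat)) \<otimes> y"
    using inv_pow[of 7] x y yy by (metis m_assoc)
  then have "x [^] (7::nat) = inv (x [^] (7::nat))" using x y by simp
  then have "x [^] (7::nat) \<otimes> x [^] (7::nat) = \<one>" using x by (metis nat_pow_closed r_inv)
  then show 14: "x [^] (14::nat) = \<one>" using x by (simp add: nat_pow_mult)
  have "x [^] (13 * n) \<otimes> x [^] n = (x [^] (14::nat)) [^] n"
    using x by (simp add: nat_pow_mult nat_pow_pow)
  then have "x [^] (13 * n) \<otimes> x [^] n = \<one>" unfolding 14 by simp
  then have "inv (x [^] n) = x [^] (13 * n)" using x by (metis inv_equality nat_pow_closed)
  then show "y \<otimes> x [^] n = x [^] (13 * n) \<otimes> y" using inv_pow[of n] by simp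
qed

text \<open>With b = y^-1 x y the relation reads b x^2 = x^3 b^2. As y^2 = x^7 commutes with x,
  conjugation by y swaps x and b, so x b^2 = b^3 x^2 as well. Substituting gives x^2 b^2 = 1, then b
  x^2 = x and b x = 1.\<close>

lemma (in group) exotic_relations:
  assumes x: "x \<in> carrier G" and y: "y \<in> carrier G"
    and yy: "y \<otimes> y = x [^] (7::nat)"
    and ex: "inv y \<otimes> x \<otimes> y \<otimes> x \<otimes> x = x \<otimes> x \<otimes> x \<otimes> inv y \<otimes> x \<otimes> x \<otimes> y"
  shows "x \<otimes> y \<otimes> x = y"
proof -
  define c where "c g = inv y \<otimes> g \<otimes> y" for g
  define b where "b = c x"
  have c_closed: "c g \<in> carrier G" if "g \<in> carrier G" for g using that y by (simp add: c_def)
  have b: "b \<in> carrier G" using x by (simp add: b_def c_closed)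
  have c_mult: "c (g \<otimes> h) = c g \<otimes> c h" if "g \<in> carrier G" "h \<in> carrier G" for g h
  proof -
    have "y \<otimes> (inv y \<otimes> (h \<otimes> y)) = h \<otimes> y"
      using that y by (simp add: m_assoc[symmetric])
    then show ?thesis using that y by (simp add: c_def m_assoc)
  qed
  have "x \<otimes> (y \<otimes> y) = y \<otimes> y \<otimes> x" unfolding yy using x by (metis nat_pow_Suc nat_pow_Suc2)
  then have "inv y \<otimes> (inv y \<otimes> (x \<otimes> (y \<otimes> y))) = inv y \<otimes> (inv y \<otimes> (y \<otimes> y \<otimes> x))" by simp
  moreover have "inv y \<otimes> (y \<otimes> g) = g" if "g \<in> carrier G" for g
    using that y by (simp add: m_assoc[symmetric])
  ultimately have cb: "c b = x" using x y by (simp add: b_def c_def m_assoc)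
  have e1: "b \<otimes> x \<otimes> x = x \<otimes> x \<otimes> x \<otimes> (b \<otimes> b)"
    using ex x y unfolding b_def c_mult[OF x x, symmetric] by (simp add: c_def m_assoc)
  have e2: "x \<otimes> b \<otimes> b = b \<otimes> b \<otimes> b \<otimes> (x \<otimes> x)"
    using arg_cong[OF e1, of c] x b by (simp add: c_mult cb b_def[symmetric])
  have "b \<otimes> (x \<otimes> x) = x \<otimes> x \<otimes> (x \<otimes> b \<otimes> b)" using e1 x b by (simp add: m_assoc)
  also have "\<dots> = x \<otimes> x \<otimes> b \<otimes> b \<otimes> b \<otimes> (x \<otimes> x)" unfolding e2 using x b by (simp add: m_assoc)
  finally have "b = x \<otimes> x \<otimes> b \<otimes> b \<otimes> b" using x b by simp
  then have one: "x \<otimes> x \<otimes> b \<otimes> b = \<one>" using x b by (metis m_closed r_cancel_one)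
  have "b \<otimes> x \<otimes> x = x \<otimes> (x \<otimes> x \<otimes> b \<otimes> b)" using e1 x b by (simp add: m_assoc)
  then have "b \<otimes> x \<otimes> x = x" using one x by simp
  then have "b \<otimes> x = \<one>" using x b by (metis m_closed r_cancel_one)
  then have "y \<otimes> (inv y \<otimes> (x \<otimes> y \<otimes> x)) = y" using x y by (simp add: b_def c_def m_assoc)
  then show ?thesis using x y by (simp add: m_assoc[symmetric])
qed

section \<open>Evaluation of words in the group of order 28, and normal forms\<close>

fun letter_eval :: "gen \<times> bool \<Rightarrow> q28" where
  "letter_eval (GenX, True) = Q 1 False"
| "letter_eval (GenX, False) = Q 13 False"
| "letter_eval (GenY, True) = Q 0 True"
| "letter_eval (GenY, False) = Q 7 True"

definition word_eval :: "gen word \<Rightarrow> q28" where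
  "word_eval w = sum_list (map letter_eval w)"

lemma word_eval_simps [simp]:
  "word_eval [] = 0" "word_eval (l # w) = letter_eval l + word_eval w"
  "word_eval (u @ v) = word_eval u + word_eval v"
  by (simp_all add: word_eval_def)

lemma letter_eval_cancel: "letter_eval (x, b) + letter_eval (x, \<not> b) = 0"
  using numeral_14 by (cases x; cases b) (simp_all add: zero_q28_def)

text \<open>The first condition makes evaluation well defined on classes; the other two bring every
  word to a normal form, which makes evaluation injective.\<close>

definition presents_q28 :: "gen presentation \<Rightarrow> bool" where
  "presents_q28 R \<longleftrightarrow> (\<forall>r\<in>set R. word_eval r = 0) \<and>
    word_eq R (gX @ gY @ gX) gY \<and> word_eq R (gY @ gY) (word_pow gX 7)"

lemma word_eq_eval:
  assumes "word_eq R u v" "\<forall>r\<in>set R. word_eval r = 0"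
  shows "word_eval u = word_eval v"
  using assms
proof (induction rule: word_eq.induct)
  case (cancel u x b v)
  then show ?case using letter_eval_cancel[of x b] by (simp flip: add.assoc)
qed auto

definition class_eval :: "gen word set \<Rightarrow> q28" where
  "class_eval A = word_eval (SOME w. w \<in> A)"

lemma class_eval_class:
  assumes "presents_q28 R"
  shows "class_eval (word_class R w) = word_eval w"
proof -
  have "w \<in> word_class R w" by (simp add: word_rel_def word_eq.refl)
  then have "(SOME v. v \<in> word_class R w) \<in> word_class R w" by (rule someI)
  then have "word_eq R w (SOME v. v \<in> word_class R w)" by (simp add: word_rel_def)
  then show ?thesis using word_eq_eval assms unfolding presents_q28_def class_eval_def by metis
qed

lemma word_class_pow:
  "word_class R (word_pow w n) = word_class R w [^]\<^bsub>presented_group R\<^esub> n"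
proof -
  interpret group "presented_group R" by (rule group_presented_group)
  have w: "word_class R w \<in> carrier (presented_group R)" by (auto simp: carrier_presented_group)
  show ?thesis
  proof (induction n)
    case 0
    then show ?case by (simp add: word_pow_def one_presented_group)
  next
    case (Suc n)
    have "word_class R (word_pow w (Suc n)) =
        word_class R w \<otimes>\<^bsub>presented_group R\<^esub> word_class R (word_pow w n)"
      by (simp add: word_pow_def mult_presented_group)
    then show ?case unfolding Suc using w nat_pow_Suc2 by metis
  qed
qed

text \<open>The elements x^n and x^n y include the identity and are closed under left multiplication
  by every letter, so they exhaust the group.\<close>

lemma word_normal_form:
  assumes "presents_q28 R"
  shows "\<exists>n. word_class R w = word_class R gX [^]\<^bsub>presented_group R\<^esub> (n::nat) \<or>
    word_class R w = word_class R gX [^]\<^bsub>presented_group R\<^esub> n \<otimes>\<^bsub>presented_group R\<^esub> word_class R gY"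
    "word_class R gX [^]\<^bsub>presented_group R\<^esub> (14::nat) = \<one>\<^bsub>presented_group R\<^esub>"
proof -
  interpret group "presented_group R" by (rule group_presented_group)
  let ?G = "presented_group R"
  let ?x = "word_class R gX" and ?y = "word_class R gY"
  have c: "word_class R w \<in> carrier ?G" for w by (auto simp: carrier_presented_group)
  have "?x \<otimes>\<^bsub>?G\<^esub> ?y \<otimes>\<^bsub>?G\<^esub> ?x = ?y" "?y \<otimes>\<^bsub>?G\<^esub> ?y = ?x [^]\<^bsub>?G\<^esub> (7::nat)"
    using assms by (simp_all add: mult_presented_group word_class_eq_iff presents_q28_def flip: word_class_pow)
  note rel = quaternion_relations[OF c c this]
  show 14: "?x [^]\<^bsub>?G\<^esub> (14::nat) = \<one>\<^bsub>?G\<^esub>" by (rule rel(1))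
  have yy: "?y \<otimes>\<^bsub>?G\<^esub> ?y = ?x [^]\<^bsub>?G\<^esub> (7::nat)" by fact
  define N where "N = range (\<lambda>n::nat. ?x [^]\<^bsub>?G\<^esub> n) \<union> range (\<lambda>n::nat. ?x [^]\<^bsub>?G\<^esub> n \<otimes>\<^bsub>?G\<^esub> ?y)"
  have xN: "?x [^]\<^bsub>?G\<^esub> (m::nat) \<otimes>\<^bsub>?G\<^esub> g \<in> N" if "g \<in> N" for g m
    using that c by (auto simp: N_def nat_pow_mult m_assoc[symmetric])
  have yN: "?y \<otimes>\<^bsub>?G\<^esub> g \<in> N" if g: "g \<in> N" for g
  proof -
    consider n where "g = ?x [^]\<^bsub>?G\<^esub> (n::nat)" | n where "g = ?x [^]\<^bsub>?G\<^esub> (n::nat) \<otimes>\<^bsub>?G\<^esub> ?y"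
      using g by (auto simp: N_def)
    then show ?thesis
    proof cases
      case 1
      then show ?thesis using rel(2)[of n] by (auto simp: N_def)
    next
      case 2
      have "?y \<otimes>\<^bsub>?G\<^esub> g = (?y \<otimes>\<^bsub>?G\<^esub> ?x [^]\<^bsub>?G\<^esub> n) \<otimes>\<^bsub>?G\<^esub> ?y" using c by (simp add: 2 m_assoc)
      also have "\<dots> = ?x [^]\<^bsub>?G\<^esub> (13 * n) \<otimes>\<^bsub>?G\<^esub> (?y \<otimes>\<^bsub>?G\<^esub> ?y)" unfolding rel(2) using c by (simp add: m_assoc)
      also have "\<dots> = ?x [^]\<^bsub>?G\<^esub> (13 * n + 7)" unfolding yy using c by (simp add: nat_pow_mult)
      finally show ?thesis by (auto simp: N_def)
    qed
  qed
  have letters: "word_class R [l] \<in> {?x, ?x [^]\<^bsub>?G\<^esub> (13::nat), ?y, ?x [^]\<^bsub>?G\<^esub> (7::nat) \<otimes>\<^bsub>?G\<^esub> ?y}" for l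
  proof -
    have inv: "word_class R [(z, False)] = inv\<^bsub>?G\<^esub> (word_class R [(z, True)])" for z
    proof (rule inv_equality[symmetric])
      show "word_class R [(z, False)] \<otimes>\<^bsub>?G\<^esub> word_class R [(z, True)] = \<one>\<^bsub>?G\<^esub>"
        using word_eq.cancel[of R "[]" z False "[]"]
        by (simp add: mult_presented_group one_presented_group word_class_eq_iff)
    qed (rule c)+
    have "inv\<^bsub>?G\<^esub> ?x = ?x [^]\<^bsub>?G\<^esub> (13::nat)"
      by (rule inv_equality) (use 14 c nat_pow_Suc[of ?x 13] in simp_all)
    moreover have "inv\<^bsub>?G\<^esub> ?y = ?x [^]\<^bsub>?G\<^esub> (7::nat) \<otimes>\<^bsub>?G\<^esub> ?y"
      by (rule inv_equality) (use 14 c in \<open>simp_all add: m_assoc yy nat_pow_mult\<close>)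
    moreover obtain z b where "l = (z, b)" by (cases l)
    ultimately show ?thesis using inv c by (cases z; cases b) auto
  qed
  have "word_class R w \<in> N"
  proof (induction w)
    case Nil
    have "?x [^]\<^bsub>?G\<^esub> (0::nat) \<in> N" unfolding N_def by blast
    then show ?case by (simp add: one_presented_group)
  next
    case (Cons l w)
    have "word_class R (l # w) = word_class R [l] \<otimes>\<^bsub>?G\<^esub> word_class R w"
      by (simp add: mult_presented_group)
    moreover have "?x [^]\<^bsub>?G\<^esub> (7::nat) \<otimes>\<^bsub>?G\<^esub> ?y \<otimes>\<^bsub>?G\<^esub> word_class R w \<in> N"
      using xN[OF yN[OF Cons], of 7] c by (simp add: m_assoc)
    moreover have "?x \<otimes>\<^bsub>?G\<^esub> word_class R w \<in> N" using xN[OF Cons, of 1] c by simp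
    ultimately show ?case using letters[of l] xN[OF Cons, of 13] yN[OF Cons] by auto
  qed
  then show "\<exists>n. word_class R w = ?x [^]\<^bsub>?G\<^esub> (n::nat) \<or> word_class R w = ?x [^]\<^bsub>?G\<^esub> n \<otimes>\<^bsub>?G\<^esub> ?y"
    by (auto simp: N_def)
qed

lemma word_eval_pow: "word_eval (word_pow gX n) = Q (of_nat n) False"
  by (induction n) (simp_all add: word_pow_def zero_q28_def)

text \<open>Evaluation determines the exponent modulo 14 and the presence of y in a normal form, and
  x^14 = 1 identifies normal forms that agree in both.\<close>

lemma word_class_eqI:
  assumes "presents_q28 R" "word_eval u = word_eval v"
  shows "word_class R u = word_class R v"
proof -
  interpret group "presented_group R" by (rule group_presented_group)
  let ?G = "presented_group R"
  let ?x = "word_class R gX"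
  have x: "?x \<in> carrier ?G" by (auto simp: carrier_presented_group)
  have nf: "\<exists>n b. word_class R w = word_class R (word_pow gX n @ (if b then gY else []))" for w
  proof -
    obtain n where "word_class R w = word_class R (word_pow gX n) \<or>
        word_class R w = word_class R (word_pow gX n @ gY)"
      using word_normal_form(1)[OF assms(1), of w]
      unfolding mult_presented_group[symmetric] word_class_pow by blast
    then show ?thesis
    proof
      assume "word_class R w = word_class R (word_pow gX n)"
      then show ?thesis by (intro exI[of _ n] exI[of _ False]) simp
    next
      assume "word_class R w = word_class R (word_pow gX n @ gY)"
      then show ?thesis by (intro exI[of _ n] exI[of _ True]) simp
    qed
  qed
  have ev: "word_eval w = Q (of_nat n) b"
    if "word_class R w = word_class R (word_pow gX n @ (if b then gY else []))" for w n b
    using arg_cong[OF that, of class_eval]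
    by (cases b) (simp_all add: class_eval_class[OF assms(1)] word_eval_pow)
  obtain n b m c where u: "word_class R u = word_class R (word_pow gX n @ (if b then gY else []))"
    and v: "word_class R v = word_class R (word_pow gX m @ (if c then gY else []))"
    using nf by metis
  have "Q (of_nat n) b = Q (of_nat m) c" using ev[OF u] ev[OF v] assms(2) by simp
  then have mn: "n mod 14 = m mod 14" and bc: "b = c" by (simp_all add: of_nat_14_eq)
  have red: "?x [^]\<^bsub>?G\<^esub> k = ?x [^]\<^bsub>?G\<^esub> (k mod 14)" for k :: nat
  proof -
    have "?x [^]\<^bsub>?G\<^esub> k = ?x [^]\<^bsub>?G\<^esub> (14 * (k div 14) + k mod 14)" by simp
    also have "\<dots> = (?x [^]\<^bsub>?G\<^esub> (14::nat)) [^]\<^bsub>?G\<^esub> (k div 14) \<otimes>\<^bsub>?G\<^esub> ?x [^]\<^bsub>?G\<^esub> (k mod 14)"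
      using x by (simp only: nat_pow_mult nat_pow_pow)
    finally show ?thesis using x by (simp add: word_normal_form(2)[OF assms(1)])
  qed
  have "word_class R (word_pow gX n) = word_class R (word_pow gX m)"
    unfolding word_class_pow using red[of n] red[of m] mn by simp
  then show ?thesis unfolding u v bc mult_presented_group[symmetric] by (simp only:)
qed

text \<open>The common model through which the three presented groups are identified.\<close>

definition q28_group :: "q28 monoid" where
  "q28_group = \<lparr>carrier = UNIV, monoid.mult = (+), one = 0\<rparr>"

lemma word_eval_surj: "\<exists>w. word_eval w = q"
proof (cases q)
  case (Q i b)
  obtain n where "i = of_nat n" by (rule of_nat_14_surj)
  then have "word_eval (word_pow gX n @ (if b then gY else [])) = q"
    by (simp add: word_eval_pow Q zero_q28_def)
  then show ?thesis by blast
qed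

lemma class_eval_iso:
  assumes "presents_q28 R"
  shows "class_eval \<in> iso (presented_group R) q28_group"
proof (rule isoI)
  show "class_eval \<in> hom (presented_group R) q28_group"
    by (rule homI) (auto simp: q28_group_def carrier_presented_group mult_presented_group class_eval_class[OF assms])
  show "bij_betw class_eval (carrier (presented_group R)) (carrier q28_group)"
    unfolding bij_betw_def
  proof
    show "inj_on class_eval (carrier (presented_group R))"
    proof (rule inj_onI)
      fix A B
      assume "A \<in> carrier (presented_group R)" "B \<in> carrier (presented_group R)"
        and eq: "class_eval A = class_eval B"
      then obtain u v where uv: "A = word_class R u" "B = word_class R v" unfolding carrier_presented_group by blast
      show "A = B" unfolding uv
        by (rule word_class_eqI[OF assms]) (use eq in \<open>simp only: uv class_eval_class[OF assms]\<close>)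
    qed
    show "class_eval ` carrier (presented_group R) = carrier q28_group"
    proof -
      have "q \<in> class_eval ` carrier (presented_group R)" for q
      proof -
        obtain w where "word_eval w = q" using word_eval_surj by blast
        then have "class_eval (word_class R w) = q" by (simp only: class_eval_class[OF assms])
        then show ?thesis unfolding carrier_presented_group by blast
      qed
      then show ?thesis by (auto simp: q28_group_def)
    qed
  qed
qed

lemma relation_word_eq:
  assumes "relation a b \<in> set R"
  shows "word_eq R a b"
proof -
  interpret group "presented_group R" by (rule group_presented_group)
  let ?G = "presented_group R"
  have c: "word_class R w \<in> carrier ?G" for w by (auto simp: carrier_presented_group)
  have "word_class R (word_inv a) \<otimes>\<^bsub>?G\<^esub> word_class R a = \<one>\<^bsub>?G\<^esub>"
    by (simp add: mult_presented_group one_presented_group word_class_eq_iff word_eq_inv_left)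
  moreover have "word_class R (word_inv a) \<otimes>\<^bsub>?G\<^esub> word_class R b = \<one>\<^bsub>?G\<^esub>"
    using word_eq.relator[OF assms, of "[]" "[]"]
    by (simp add: mult_presented_group one_presented_group word_class_eq_iff relation_def)
  ultimately have "word_class R (word_inv a) \<otimes>\<^bsub>?G\<^esub> word_class R a =
      word_class R (word_inv a) \<otimes>\<^bsub>?G\<^esub> word_class R b"
    by (simp only:)
  then have "word_class R a = word_class R b" using l_cancel[OF _ c c c] by blast
  then show ?thesis unfolding word_class_eq_iff .
qed

lemma word_pow_numeral: "word_pow w (numeral k) = w @ word_pow w (pred_numeral k)"
  "word_pow w (Suc n) = w @ word_pow w n" "word_pow w 0 = []" "word_pow w 1 = w"
  by (simp_all add: word_pow_def numeral_eq_Suc)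

definition quaternion_presentation :: "gen presentation" where
  "quaternion_presentation = [relation (word_pow gY 2) (word_pow gX 7), relation gY (gX @ gY @ gX)]"

lemma presents_quaternion: "presents_q28 quaternion_presentation"
proof -
  have "word_eq quaternion_presentation (word_pow gY 2) (word_pow gX 7)"
    "word_eq quaternion_presentation gY (gX @ gY @ gX)"
    by (auto intro!: relation_word_eq simp: quaternion_presentation_def)
  moreover have "\<forall>r\<in>set quaternion_presentation. word_eval r = 0"
    by (simp add: quaternion_presentation_def relation_def word_inv_def word_pow_numeral zero_q28_def)
  ultimately show ?thesis unfolding presents_q28_def by (simp add: word_pow_numeral word_eq.sym)
qed

lemma presents_standard: "presents_q28 standard_presentation"
proof -
  have "word_eq standard_presentation (word_pow gY 2) (word_pow gX 7)"
    "word_eq standard_presentation (gX @ gY @ gX) gY"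
    by (auto intro!: relation_word_eq simp: standard_presentation_def)
  moreover have "\<forall>r\<in>set standard_presentation. word_eval r = 0"
    by (simp add: standard_presentation_def relation_def word_inv_def word_pow_numeral zero_q28_def)
  ultimately show ?thesis unfolding presents_q28_def by (simp add: word_pow_numeral)
qed

lemma presents_exotic: "presents_q28 exotic_presentation"
proof -
  let ?R = exotic_presentation
  interpret group "presented_group ?R" by (rule group_presented_group)
  let ?G = "presented_group ?R"
  have c: "word_class ?R w \<in> carrier ?G" for w by (auto simp: carrier_presented_group)
  have 1: "word_eq ?R (word_pow gY 2) (word_pow gX 7)"
    and 2: "word_eq ?R (gY_inv @ gX @ gY @ word_pow gX 2) (word_pow gX 3 @ gY_inv @ word_pow gX 2 @ gY)"
    by (auto intro!: relation_word_eq simp: exotic_presentation_def)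
  have inv: "inv\<^bsub>?G\<^esub> (word_class ?R gY) = word_class ?R gY_inv"
    by (rule inv_equality) (use c word_eq.cancel[of ?R "[]" GenY False "[]"] in
      \<open>auto simp: mult_presented_group one_presented_group word_class_eq_iff\<close>)
  have "word_class ?R gX \<otimes>\<^bsub>?G\<^esub> word_class ?R gY \<otimes>\<^bsub>?G\<^esub> word_class ?R gX = word_class ?R gY"
  proof (rule exotic_relations[OF c c])
    show "word_class ?R gY \<otimes>\<^bsub>?G\<^esub> word_class ?R gY = word_class ?R gX [^]\<^bsub>?G\<^esub> (7::nat)"
      using 1 by (simp add: mult_presented_group word_class_eq_iff word_pow_numeral flip: word_class_pow)
  qed (use 2 in \<open>simp add: inv mult_presented_group word_class_eq_iff word_pow_numeral\<close>)
  then have "word_eq ?R (gX @ gY @ gX) gY" by (simp add: mult_presented_group word_class_eq_iff)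
  moreover have "\<forall>r\<in>set ?R. word_eval r = 0"
    by (simp add: exotic_presentation_def relation_def word_inv_def word_pow_numeral zero_q28_def)
  ultimately show ?thesis using 1 unfolding presents_q28_def by (simp add: word_pow_numeral)
qed

section \<open>Second homotopy modules\<close>

definition letter_lam :: "gen \<times> bool \<Rightarrow> lam" where "letter_lam l = frag_of (letter_eval l)"

text \<open>For an inverse letter, the term \<open>- letter_lam (f, b)\<close> is the source of the
  edge that is traversed backwards.\<close>

fun fox :: "gen \<Rightarrow> gen word \<Rightarrow> lam" where
  "fox e [] = 0"
| "fox e ((f, b) # w) =
    (if e = f then (if b then rot 0 else - letter_lam (f, b)) else 0) + letter_lam (f, b) * fox e w"

lemma letter_lam_simps:
  "letter_lam (GenX, True) = rot 1" "letter_lam (GenX, False) = rot 13"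
  "letter_lam (GenY, True) = flp 0" "letter_lam (GenY, False) = flp 7"
  by (simp_all add: letter_lam_def rot_def flp_def)

text \<open>The coordinate of a chain at one orbit of cells; the index is a relator number for
  2-chains and a generator for 1-chains.\<close>

definition chain_part :: "'i \<Rightarrow> (gen word set \<times> 'i \<Rightarrow>\<^sub>0 int) \<Rightarrow> lam" where
  "chain_part i = frag_extend (\<lambda>(g, k). if k = i then frag_of (class_eval g) else 0)"

lemma chain_part_simps:
  "chain_part i 0 = 0" "chain_part i (a - b) = chain_part i a - chain_part i b"
  "chain_part i (a + b) = chain_part i a + chain_part i b"
  "chain_part i (- a) = - chain_part i a"
  "chain_part i (frag_of (g, k)) = (if k = i then frag_of (class_eval g) else 0)"
  by (simp_all add: chain_part_def frag_extend_diff frag_extend_add frag_extend_minus)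

context
  fixes R :: "gen presentation"
  assumes R: "presents_q28 R"
begin

lemma class_eval_inj:
  "g \<in> carrier (presented_group R) \<Longrightarrow> h \<in> carrier (presented_group R) \<Longrightarrow>
    class_eval g = class_eval h \<longleftrightarrow> g = h"
  using class_eval_iso[OF R] by (auto simp: iso_def bij_betw_def inj_on_def)

lemma class_eval_mult:
  "g \<in> carrier (presented_group R) \<Longrightarrow> h \<in> carrier (presented_group R) \<Longrightarrow>
    class_eval (g \<otimes>\<^bsub>presented_group R\<^esub> h) = class_eval g + class_eval h"
  using class_eval_iso[OF R] by (auto simp: iso_def hom_def q28_group_def)

lemma class_eval_inv:
  assumes "g \<in> carrier (presented_group R)"
  shows "class_eval (inv\<^bsub>presented_group R\<^esub> g) = - class_eval g"
proof -
  interpret group "presented_group R" by (rule group_presented_group)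
  have "class_eval (inv\<^bsub>presented_group R\<^esub> g) + class_eval g = class_eval \<one>\<^bsub>presented_group R\<^esub>"
    using assms by (simp flip: class_eval_mult)
  also have "\<dots> = 0" unfolding one_presented_group class_eval_class[OF R] by simp
  finally show ?thesis by (simp add: eq_neg_iff_add_eq_0)
qed

lemma lookup_chain_part:
  assumes "Poly_Mapping.keys c \<subseteq> carrier (presented_group R) \<times> UNIV" "g \<in> carrier (presented_group R)"
  shows "Poly_Mapping.lookup (chain_part i c) (class_eval g) = Poly_Mapping.lookup c (g, i)"
  using assms(1)
proof (induction c rule: frag_induction)
  case (one x)
  then obtain h k where "x = (h, k)" "h \<in> carrier (presented_group R)" by auto
  then show ?case using class_eval_inj[of h g] assms(2)
    by (auto simp: chain_part_simps lookup_single when_def)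
qed (simp_all add: chain_part_simps lookup_minus)

lemma chain_part_eqI:
  fixes c d :: "gen word set \<times> 'i \<Rightarrow>\<^sub>0 int"
  assumes "Poly_Mapping.keys c \<subseteq> carrier (presented_group R) \<times> UNIV"
    "Poly_Mapping.keys d \<subseteq> carrier (presented_group R) \<times> UNIV"
    and "\<And>i. chain_part i c = chain_part i d"
  shows "c = d"
proof (rule poly_mapping_eqI)
  fix x :: "gen word set \<times> 'i"
  obtain g i where x: "x = (g, i)" by (cases x)
  show "Poly_Mapping.lookup c x = Poly_Mapping.lookup d x"
  proof (cases "g \<in> carrier (presented_group R)")
    case True
    then show ?thesis
      using lookup_chain_part[OF assms(1)] lookup_chain_part[OF assms(2)] assms(3) x by metis
  next
    case False
    then have "x \<notin> Poly_Mapping.keys c" "x \<notin> Poly_Mapping.keys d" using assms(1,2) x by auto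
    then show ?thesis by (simp add: in_keys_iff)
  qed
qed

lemma chain_part_surj1:
  "\<exists>c. Poly_Mapping.keys c \<subseteq> carrier (presented_group R) \<times> {i} \<and> chain_part i c = a \<and>
    (\<forall>j. j \<noteq> i \<longrightarrow> chain_part j c = 0)"
proof (induction a rule: frag_induct_UNIV)
  case 1
  show ?case by (rule exI[of _ 0]) (simp add: chain_part_simps)
next
  case (2 q)
  obtain w where "word_eval w = q" using word_eval_surj by blast
  then have "class_eval (word_class R w) = q" by (simp only: class_eval_class[OF R])
  then show ?case
    by (intro exI[of _ "frag_of (word_class R w, i)"])
      (auto simp: chain_part_simps carrier_presented_group)
next
  case (3 a b)
  then obtain c d where
    "Poly_Mapping.keys c \<subseteq> carrier (presented_group R) \<times> {i}" "chain_part i c = a" "\<forall>j. j \<noteq> i \<longrightarrow> chain_part j c = 0"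
    "Poly_Mapping.keys d \<subseteq> carrier (presented_group R) \<times> {i}" "chain_part i d = b" "\<forall>j. j \<noteq> i \<longrightarrow> chain_part j d = 0"
    by blast
  then show ?case using keys_diff[of c d]
    by (intro exI[of _ "c - d"]) (auto simp: chain_part_simps)
qed

lemma chain_part_surj:
  "\<exists>c. Poly_Mapping.keys c \<subseteq> carrier (presented_group R) \<times> {..<2::nat} \<and>
    chain_part 0 c = a \<and> chain_part 1 c = b"
proof -
  from chain_part_surj1[of "0::nat" a] obtain c where
    c: "Poly_Mapping.keys c \<subseteq> carrier (presented_group R) \<times> {0::nat}"
    "chain_part 0 c = a" "\<forall>j. j \<noteq> 0 \<longrightarrow> chain_part j c = 0"
    by (elim exE conjE) (rule that)
  from chain_part_surj1[of "1::nat" b] obtain d where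
    d: "Poly_Mapping.keys d \<subseteq> carrier (presented_group R) \<times> {1::nat}"
    "chain_part 1 d = b" "\<forall>j. j \<noteq> 1 \<longrightarrow> chain_part j d = 0"
    by (elim exE conjE) (rule that)
  have k: "Poly_Mapping.keys c \<subseteq> carrier (presented_group R) \<times> {..<2}"
    "Poly_Mapping.keys d \<subseteq> carrier (presented_group R) \<times> {..<2}"
    by (rule order_trans[OF c(1)], force) (rule order_trans[OF d(1)], force)
  have "Poly_Mapping.keys (c + d) \<subseteq> carrier (presented_group R) \<times> {..<2}"
    by (rule order_trans[OF keys_add Un_least[OF k]])
  moreover have "chain_part 0 d = 0" "chain_part 1 c = 0" using c(3) d(3) by simp_all
  ultimately show ?thesis using c(2) d(2) by (intro exI[of _ "c + d"]) (simp add: chain_part_simps)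
qed

section \<open>The boundary map and the module action in coordinates\<close>

definition edge_chain :: "(('e \<times> bool) list) \<Rightarrow> 'e \<Rightarrow>\<^sub>0 int" where
  "edge_chain p = sum_list (map (\<lambda>(e, b). if b then frag_of e else - frag_of e) p)"

lemma edge_chain_simps: "edge_chain [] = 0"
  "edge_chain ((e, b) # p) = (if b then frag_of e else - frag_of e) + edge_chain p"
  by (simp_all add: edge_chain_def)

text \<open>Fox derivatives record the edges of a lifted word, and the starting vertex enters as a
  left factor that moves along in the induction.\<close>

lemma lift_path_chain:
  assumes "g \<in> carrier (presented_group R)"
  shows "chain_part e (edge_chain (lift_path R g w)) = frag_of (class_eval g) * fox e w \<and>
    Poly_Mapping.keys (edge_chain (lift_path R g w)) \<subseteq> carrier (presented_group R) \<times> UNIV"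
  using assms
proof (induction w arbitrary: g)
  case Nil
  show ?case by (simp add: edge_chain_simps chain_part_simps)
next
  case (Cons l w)
  obtain f b where l: "l = (f, b)" by (cases l)
  interpret group "presented_group R" by (rule group_presented_group)
  define h where "h = g \<otimes>\<^bsub>presented_group R\<^esub> word_class R [(f, b)]"
  have lc: "word_class R [(f, b)] \<in> carrier (presented_group R)" by (auto simp: carrier_presented_group)
  have h: "h \<in> carrier (presented_group R)"
    using Cons.prems lc by (simp add: h_def)
  have "class_eval h = class_eval g + letter_eval (f, b)"
    unfolding h_def class_eval_mult[OF Cons.prems lc] class_eval_class[OF R] by simp
  then have ev: "frag_of (class_eval h) = frag_of (class_eval g) * letter_lam (f, b)"
    by (simp add: letter_lam_def frag_of_mult)
  have step: "edge_chain (lift_path R g (l # w)) =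
      (if b then frag_of (g, f) else - frag_of (h, f)) + edge_chain (lift_path R h w)"
    by (simp add: l Let_def h_def edge_chain_simps)
  note IH = Cons.IH[OF h]
  have "chain_part e (edge_chain (lift_path R g (l # w))) = frag_of (class_eval g) * fox e (l # w)"
    unfolding step chain_part_simps conjunct1[OF IH]
    by (simp add: chain_part_simps l ev distrib_left mult.assoc rot_0)
  moreover have "Poly_Mapping.keys (if b then frag_of (g, f) else - frag_of (h, f)) \<subseteq>
      carrier (presented_group R) \<times> UNIV"
    using Cons.prems h by auto
  then have "Poly_Mapping.keys (edge_chain (lift_path R g (l # w))) \<subseteq> carrier (presented_group R) \<times> UNIV"
    unfolding step using conjunct2[OF IH] by (intro order_trans[OF keys_add Un_least])
  ultimately show ?case by blast
qed

lemma chain_part_boundary2: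
  assumes "Poly_Mapping.keys c \<subseteq> carrier (presented_group R) \<times> {..<2}" "length R = 2"
  shows "chain_part e (boundary2 (universal_cover R) c) =
      chain_part 0 c * fox e (R ! 0) + chain_part 1 c * fox e (R ! 1) \<and>
    Poly_Mapping.keys (boundary2 (universal_cover R) c) \<subseteq> carrier (presented_group R) \<times> UNIV"
  using assms(1)
proof (induction c rule: frag_induction)
  case zero
  show ?case by (simp add: boundary2_def chain_part_simps)
next
  case (one x)
  then obtain g i where x: "x = (g, i)" "g \<in> carrier (presented_group R)" "i < 2" by auto
  have "boundary2 (universal_cover R) (frag_of x) = edge_chain (lift_path R g (R ! i))"
    by (simp add: boundary2_def edge_chain_def x)
  then show ?case using x lift_path_chain[OF x(2)]
    by (auto simp: chain_part_simps less_Suc_eq numeral_2_eq_2)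
next
  case (diff a b)
  have "boundary2 (universal_cover R) (a - b) = boundary2 (universal_cover R) a - boundary2 (universal_cover R) b"
    by (simp add: boundary2_def frag_extend_diff)
  then show ?case using diff keys_diff[of "boundary2 (universal_cover R) a" "boundary2 (universal_cover R) b"]
    by (auto simp: chain_part_simps left_diff_distrib)
qed

lemma carrier_pi2:
  assumes "length R = 2"
  shows "c \<in> carrier (pi2 R) \<longleftrightarrow> Poly_Mapping.keys c \<subseteq> carrier (presented_group R) \<times> {..<2} \<and>
    (\<forall>e. chain_part 0 c * fox e (R ! 0) + chain_part 1 c * fox e (R ! 1) = 0)"
proof (cases "Poly_Mapping.keys c \<subseteq> carrier (presented_group R) \<times> {..<2}")
  case True
  note bd = chain_part_boundary2[OF True assms]
  have "boundary2 (universal_cover R) c = 0 \<longleftrightarrow> (\<forall>e. chain_part e (boundary2 (universal_cover R) c) = 0)"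
    using chain_part_eqI[of "boundary2 (universal_cover R) c" 0] bd by (auto simp: chain_part_simps)
  then show ?thesis using True bd by (simp add: pi2_def homology2_def assms)
qed (auto simp: pi2_def homology2_def assms)

text \<open>The anti-involution g to g^-1, which turns the right action through inverses into left
  multiplication on coordinates.\<close>

definition act_coeff :: "(gen word set \<Rightarrow>\<^sub>0 int) \<Rightarrow> lam" where
  "act_coeff = frag_extend (\<lambda>h. frag_of (- class_eval h))"

lemma chain_part_act:
  assumes "Poly_Mapping.keys c \<subseteq> carrier (presented_group R) \<times> UNIV"
    "Poly_Mapping.keys a \<subseteq> carrier (presented_group R)"
  shows "chain_part i (chain2_act (presented_group R) c a) = act_coeff a * chain_part i c"
  using assms(2)
proof (induction a rule: frag_induction)
  case (one h)
  interpret group "presented_group R" by (rule group_presented_group)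
  from assms(1) show ?case
  proof (induction c rule: frag_induction)
    case (one x)
    then obtain g k where "x = (g, k)" "g \<in> carrier (presented_group R)" by auto
    then show ?case using \<open>h \<in> carrier (presented_group R)\<close>
      by (simp add: chain2_act_of chain_part_simps act_coeff_def class_eval_mult class_eval_inv frag_of_mult)
  qed (simp_all add: chain2_act_0 chain2_act_diff1 chain_part_simps right_diff_distrib)
qed (simp_all add: chain2_act_0 chain2_act_diff2 chain_part_simps act_coeff_def left_diff_distrib frag_extend_diff)

lemma act_coeff_surj: "\<exists>a. Poly_Mapping.keys a \<subseteq> carrier (presented_group R) \<and> act_coeff a = r"
proof (induction r rule: frag_induct_UNIV)
  case 1
  show ?case by (rule exI[of _ 0]) (simp add: act_coeff_def)
next
  case (2 q)
  obtain w where "word_eval w = - q" using word_eval_surj by blast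
  then have "- class_eval (word_class R w) = q" by (simp only: class_eval_class[OF R] minus_minus)
  then show ?case
    by (intro exI[of _ "frag_of (word_class R w)"]) (auto simp: act_coeff_def carrier_presented_group)
next
  case (3 a b)
  then obtain c d where "Poly_Mapping.keys c \<subseteq> carrier (presented_group R)" "act_coeff c = a"
    "Poly_Mapping.keys d \<subseteq> carrier (presented_group R)" "act_coeff d = b" by blast
  then show ?case using keys_diff[of c d]
    by (intro exI[of _ "c - d"]) (auto simp: act_coeff_def frag_extend_diff)
qed

end

lemmas fox_simps = relation_def word_inv_def word_pow_numeral letter_lam_simps distrib_left distrib_right
  left_diff_distrib right_diff_distrib rot_flp_mult

lemma standard_fox:
  "fox GenX (standard_presentation ! 0) = rot 7 + rot 8 + rot 9 + rot 10 + rot 11 + rot 12 + rot 13"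
  "fox GenY (standard_presentation ! 0) = - (rot 7 + flp 7)"
  "fox GenX (standard_presentation ! 1) = - (rot 13 + flp 7)"
  "fox GenY (standard_presentation ! 1) = flp 7 - flp 6"
  by (simp_all add: standard_presentation_def fox_simps flip: numeral_2_eq_2 del: One_nat_def)

text \<open>The second exotic relation follows from xyx = y alone, as both of its sides become x;
  this is why its Fox row is a left multiple of the standard one.\<close>

lemma exotic_fox:
  "fox e (exotic_presentation ! 0) = fox e (standard_presentation ! 0)"
  "fox e (exotic_presentation ! 1) = exo_factor * fox e (standard_presentation ! 1)"
  by (cases e; simp add: standard_presentation_def exotic_presentation_def exo_factor_def fox_simps
      flip: numeral_2_eq_2 del: One_nat_def)+

lemma length_presentations: "length standard_presentation = 2" "length exotic_presentation = 2"
  by (simp_all add: standard_presentation_def exotic_presentation_def)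

lemma all_gen: "(\<forall>e. P e) \<longleftrightarrow> P GenX \<and> P GenY"
  by (metis gen.exhaust)

lemma carrier_pi2_standard:
  "c \<in> carrier (pi2 standard_presentation) \<longleftrightarrow>
    Poly_Mapping.keys c \<subseteq> carrier (presented_group standard_presentation) \<times> {..<2} \<and>
    std_solution (chain_part 0 c) (chain_part 1 c)"
  unfolding carrier_pi2[OF presents_standard length_presentations(1)] all_gen standard_fox std_solution_def
  by (simp add: eq_neg_iff_add_eq_0 algebra_simps) (metis eq_iff_diff_eq_0)

lemma carrier_pi2_exotic:
  "c \<in> carrier (pi2 exotic_presentation) \<longleftrightarrow>
    Poly_Mapping.keys c \<subseteq> carrier (presented_group exotic_presentation) \<times> {..<2} \<and>
    exo_solution (chain_part 0 c) (chain_part 1 c)"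
  unfolding carrier_pi2[OF presents_exotic length_presentations(2)] exotic_fox all_gen standard_fox
    exo_solution_def std_solution_def mult.assoc[symmetric]
  by (simp add: eq_neg_iff_add_eq_0 algebra_simps) (metis eq_iff_diff_eq_0)

section \<open>Cyclicity as an invariant, and its transfer between identifications\<close>

definition cyclic_pi2 :: "gen presentation \<Rightarrow> bool" where
  "cyclic_pi2 R \<longleftrightarrow> (\<exists>e\<in>carrier (pi2 R). \<forall>c\<in>carrier (pi2 R).
    \<exists>a\<in>carrier (group_ring (presented_group R)). c = rsmult (pi2 R) e a)"

lemma carrier_group_ring: "a \<in> carrier (group_ring G) \<longleftrightarrow> Poly_Mapping.keys a \<subseteq> carrier G"
  by (simp add: group_ring_def)

lemma rsmult_pi2: "rsmult (pi2 R) = chain2_act (presented_group R)"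
  by (simp add: pi2_def)

lemma cyclic_pi2_standard: "cyclic_pi2 standard_presentation"
proof -
  let ?R = standard_presentation
  let ?G = "presented_group ?R"
  obtain e where e: "Poly_Mapping.keys e \<subseteq> carrier ?G \<times> {..<2::nat}"
    "chain_part 0 e = rot 8 - rot 7" "chain_part 1 e = rot 8 - flp 0"
    using chain_part_surj[OF presents_standard] by blast
  have "\<exists>a\<in>carrier (group_ring ?G). c = rsmult (pi2 ?R) e a" if c: "c \<in> carrier (pi2 ?R)" for c
  proof -
    have k: "Poly_Mapping.keys c \<subseteq> carrier ?G \<times> {..<2}" and s: "std_solution (chain_part 0 c) (chain_part 1 c)"
      using c unfolding carrier_pi2_standard by blast+
    obtain r where r: "chain_part 0 c = r * (rot 8 - rot 7)" "chain_part 1 c = r * (rot 8 - flp 0)"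
      using std_solution_cyclic[OF s] by blast
    obtain a where a: "Poly_Mapping.keys a \<subseteq> carrier ?G" "act_coeff a = r"
      using act_coeff_surj[OF presents_standard] by blast
    have U: "A \<subseteq> carrier ?G \<times> UNIV" if "A \<subseteq> carrier ?G \<times> {..<2::nat}" for A using that by auto
    have ka: "Poly_Mapping.keys (chain2_act ?G e a) \<subseteq> carrier ?G \<times> {..<2}"
      by (rule keys_chain2_act[OF group_presented_group e(1) a(1)])
    have "c = chain2_act ?G e a"
    proof (rule chain_part_eqI[OF presents_standard U[OF k] U[OF ka]])
      fix i :: nat
      consider "i = 0" | "i = 1" | "i \<ge> 2" by linarith
      then show "chain_part i c = chain_part i (chain2_act ?G e a)"
      proof cases
        case 3
        \<comment> \<open>Only the indices 0 and 1 carry 2-cells, while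
          \<open>chain_part_eqI\<close> asks for every natural index.\<close>
        have "chain_part i c = 0" if "Poly_Mapping.keys c \<subseteq> carrier ?G \<times> {..<2}" for c
          using that
          by (induction c rule: frag_induction) (use 3 in \<open>auto simp: chain_part_simps\<close>)
        then show ?thesis using k ka by simp
      qed (simp_all add: chain_part_act[OF presents_standard U[OF e(1)] a(1)] a(2) r e del: One_nat_def)
    qed
    then show ?thesis unfolding rsmult_pi2 by (rule bexI) (simp add: carrier_group_ring a(1))
  qed
  moreover have "e \<in> carrier (pi2 ?R)"
    unfolding carrier_pi2_standard e by (rule conjI[OF e(1) std_solution_gen])
  ultimately show ?thesis unfolding cyclic_pi2_def by blast
qed

lemma not_cyclic_pi2_exotic: "\<not> cyclic_pi2 exotic_presentation"
proof
  let ?R = exotic_presentation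
  let ?G = "presented_group ?R"
  assume "cyclic_pi2 ?R"
  then obtain e where e: "e \<in> carrier (pi2 ?R)"
    and gen: "\<And>c. c \<in> carrier (pi2 ?R) \<Longrightarrow> \<exists>a\<in>carrier (group_ring ?G). c = rsmult (pi2 ?R) e a"
    unfolding cyclic_pi2_def by blast
  have ke: "Poly_Mapping.keys e \<subseteq> carrier ?G \<times> UNIV" and se: "exo_solution (chain_part 0 e) (chain_part 1 e)"
    using e unfolding carrier_pi2_exotic by auto
  show False
  proof (rule exo_not_cyclic[OF se])
    fix c' d' assume sol: "exo_solution c' d'"
    obtain m where m: "Poly_Mapping.keys m \<subseteq> carrier ?G \<times> {..<2::nat}" "chain_part 0 m = c'" "chain_part 1 m = d'"
      using chain_part_surj[OF presents_exotic] by blast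
    then have "m \<in> carrier (pi2 ?R)" using sol unfolding carrier_pi2_exotic by blast
    from gen[OF this] obtain a where "a \<in> carrier (group_ring ?G)" "m = rsmult (pi2 ?R) e a"
      by (rule bexE)
    then have a: "Poly_Mapping.keys a \<subseteq> carrier ?G" "m = chain2_act ?G e a"
      by (simp_all only: carrier_group_ring rsmult_pi2)
    show "\<exists>r. c' = r * chain_part 0 e \<and> d' = r * chain_part 1 e"
      unfolding m(2)[symmetric] m(3)[symmetric] a(2) chain_part_act[OF presents_exotic ke a(1)] by blast
  qed
qed

lemma group_ring_map_surj:
  assumes "\<psi> \<in> iso G H" "b \<in> carrier (group_ring H)"
  shows "\<exists>a\<in>carrier (group_ring G). group_ring_map \<psi> a = b"
proof -
  have "Poly_Mapping.keys b \<subseteq> carrier H" using assms(2) by (simp add: carrier_group_ring)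
  then have "\<exists>a. Poly_Mapping.keys a \<subseteq> carrier G \<and> group_ring_map \<psi> a = b"
  proof (induction b rule: frag_induction)
    case zero
    show ?case by (rule exI[of _ 0]) (simp add: group_ring_map_def)
  next
    case (one h)
    moreover have "carrier H = \<psi> ` carrier G" using assms(1) by (simp add: iso_def bij_betw_def)
    ultimately have "h \<in> \<psi> ` carrier G" by simp
    then obtain g where "g \<in> carrier G" "\<psi> g = h" by blast
    then show ?case by (intro exI[of _ "frag_of g"]) (simp add: group_ring_map_def)
  next
    case (diff a b)
    then obtain c d where "Poly_Mapping.keys c \<subseteq> carrier G" "group_ring_map \<psi> c = a"
      "Poly_Mapping.keys d \<subseteq> carrier G" "group_ring_map \<psi> d = b" by blast
    then show ?case using keys_diff[of c d]
      by (intro exI[of _ "c - d"]) (auto simp: group_ring_map_def frag_extend_diff)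
  qed
  then show ?thesis by (simp add: carrier_group_ring Bex_def)
qed

lemma group_ring_map_closed:
  assumes "\<phi> \<in> iso G H" "a \<in> carrier (group_ring G)"
  shows "group_ring_map \<phi> a \<in> carrier (group_ring H)"
proof -
  have "\<phi> ` carrier G = carrier H" using assms(1) by (auto simp: iso_def bij_betw_def)
  then show ?thesis using assms(2)
    unfolding carrier_group_ring group_ring_map_def
    by (fastforce dest!: subsetD[OF keys_frag_extend])
qed

text \<open>A generator is pulled back along f. The scalar expressing f c is lifted through \<psi>
  to the group ring of H and then pushed along \<phi>.\<close>

lemma isomorphic_cyclic_pi2:
  assumes phi: "\<phi> \<in> iso H (presented_group R)" and psi: "\<psi> \<in> iso H (presented_group S)"
    and iso: "right_module_isomorphic (group_ring H)
      (restrict_scalars (group_ring_map \<phi>) (pi2 R)) (restrict_scalars (group_ring_map \<psi>) (pi2 S))"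
    and cyc: "cyclic_pi2 S"
  shows "cyclic_pi2 R"
proof -
  obtain f where bij: "bij_betw f (carrier (pi2 R)) (carrier (pi2 S))"
    and lin: "\<And>m a. m \<in> carrier (pi2 R) \<Longrightarrow> a \<in> carrier (group_ring H) \<Longrightarrow>
      f (rsmult (pi2 R) m (group_ring_map \<phi> a)) = rsmult (pi2 S) (f m) (group_ring_map \<psi> a)"
    using iso unfolding right_module_isomorphic_def restrict_scalars_def by auto
  obtain e where e: "e \<in> carrier (pi2 S)"
    and gen: "\<And>c. c \<in> carrier (pi2 S) \<Longrightarrow>
      \<exists>a\<in>carrier (group_ring (presented_group S)). c = rsmult (pi2 S) e a"
    using cyc unfolding cyclic_pi2_def by blast
  have "e \<in> f ` carrier (pi2 R)" using e by (simp add: bij_betw_imp_surj_on[OF bij])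
  then obtain e' where e'': "e = f e'" and e': "e' \<in> carrier (pi2 R)" by (rule imageE)
  have "\<exists>a\<in>carrier (group_ring (presented_group R)). c = rsmult (pi2 R) e' a" if c: "c \<in> carrier (pi2 R)" for c
  proof -
    have "f c \<in> carrier (pi2 S)" by (rule bij_betw_apply[OF bij c])
    from gen[OF this] obtain b where
      b: "b \<in> carrier (group_ring (presented_group S))" "f c = rsmult (pi2 S) e b"
      by (rule bexE)
    from group_ring_map_surj[OF psi b(1)] obtain a where
      a: "a \<in> carrier (group_ring H)" "group_ring_map \<psi> a = b"
      by (rule bexE)
    have cl: "group_ring_map \<phi> a \<in> carrier (group_ring (presented_group R))"
      by (rule group_ring_map_closed[OF phi a(1)])
    have "f (rsmult (pi2 R) e' (group_ring_map \<phi> a)) = f c"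
      using lin[OF e' a(1)] by (simp add: e'' a b)
    moreover have "rsmult (pi2 R) e' (group_ring_map \<phi> a) \<in> carrier (pi2 R)"
      using right_module.rsmult_closed[OF right_module_pi2 e' cl] .
    ultimately have "c = rsmult (pi2 R) e' (group_ring_map \<phi> a)"
      using inj_onD[OF bij_betw_imp_inj_on[OF bij]] c by metis
    then show ?thesis using cl by (rule bexI)
  qed
  then show ?thesis using e' unfolding cyclic_pi2_def by blast
qed

theorem theoremA:
  shows "order (quaternion_group 7) = 28 \<and>
    presented_group standard_presentation \<cong> quaternion_group 7 \<and>
    presented_group exotic_presentation \<cong> quaternion_group 7 \<and>
    (\<forall>\<phi> \<in> iso (quaternion_group 7) (presented_group exotic_presentation).
     \<forall>\<psi> \<in> iso (quaternion_group 7) (presented_group standard_presentation).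
      \<not> right_module_isomorphic (group_ring (quaternion_group 7))
          (restrict_scalars (group_ring_map \<phi>) (pi2 exotic_presentation))
          (restrict_scalars (group_ring_map \<psi>) (pi2 standard_presentation)))"
proof (intro conjI ballI notI)
  have q: "quaternion_group 7 = presented_group quaternion_presentation"
    by (simp add: quaternion_group_def quaternion_presentation_def)
  have "bij_betw class_eval (carrier (quaternion_group 7)) UNIV"
    using class_eval_iso[OF presents_quaternion] by (simp add: q iso_def q28_group_def)
  then show "order (quaternion_group 7) = 28"
    using bij_betw_same_card card_q28 unfolding order_def by metis
  \<comment> \<open>Each presented group is compared with the concrete model
    \<open>q28_group\<close>.\<close>
  have sym: "q28_group \<cong> quaternion_group 7"
    unfolding q
    by (rule group.iso_sym[OF group_presented_group]) (use class_eval_iso[OF presents_quaternion] in \<open>auto simp: is_iso_def\<close>)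
  show "presented_group standard_presentation \<cong> quaternion_group 7"
    using class_eval_iso[OF presents_standard] by (intro iso_trans[OF _ sym]) (auto simp: is_iso_def)
  show "presented_group exotic_presentation \<cong> quaternion_group 7"
    using class_eval_iso[OF presents_exotic] by (intro iso_trans[OF _ sym]) (auto simp: is_iso_def)
next
  fix \<phi> \<psi>
  assume "\<phi> \<in> iso (quaternion_group 7) (presented_group exotic_presentation)"
    "\<psi> \<in> iso (quaternion_group 7) (presented_group standard_presentation)"
    "right_module_isomorphic (group_ring (quaternion_group 7))
          (restrict_scalars (group_ring_map \<phi>) (pi2 exotic_presentation))
          (restrict_scalars (group_ring_map \<psi>) (pi2 standard_presentation))"
  then have "cyclic_pi2 exotic_presentation"
    using isomorphic_cyclic_pi2 cyclic_pi2_standard by blast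
  then show False using not_cyclic_pi2_exotic by blast
qed

end
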